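(* Let the model and definitions be as in the context, and let $\alpha_1=\alpha$, $\alpha_2=1-\alpha$. Then, for $i\in\{1,2\}$, $$\delta_i^{\mathrm{spec}}=\frac1{\alpha_i^2\int_{\mathrm{supp}(Y)}\frac{\mathbb E[p(y|G)(G^2-1)]^2}{\mathbb E[p(y|G)]}\,dy},$$ and for $\delta>\delta_i^{\mathrm{spec}}$, $$\mathsf{OL}_i^{\mathrm{spec}}=\frac1{\sqrt{\beta_i^*(\delta,\alpha)+\alpha_i}},$$ where $\beta_i^*(\delta,\alpha)\in(1-\alpha_i,\infty)$ is the unique solution to the fixed point equation $$(\beta_i^*(\delta,\alpha)-(1-\alpha_i))\int_{\mathrm{supp}(Y)}\frac{\mathbb E[p(y|G)(G^2-1)]^2}{\alpha_i\,\mathbb E[p(y|G)G^2]+\beta_i^*(\delta,\alpha)\,\mathbb E[p(y|G)]}\,dy=\frac1{\alpha_i^2\delta}.$$ Finally, for $i\in\{1,2\}$ define $\mathcal T_i^*:\mathbb R\to\mathbb R$ by $$\mathcal T_i^*(y)=1-\frac1{\alpha_i\cdot\frac{\mathbb E[p(y|G)G^2]}{\mathbb E[p(y|G)]}+(1-\alpha_i)},\qquad G\sim\mathcal N(0,1).$$ Then, for $\delta>\delta_i^{\mathrm{spec}}$: (i) $\mathcal T_i^*\in\mathcal H_i$, and (ii) the value $\mathsf{OL}_i^{\mathrm{spec}}$ is achieved by $\mathcal T_i^*$.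
   Context: Model. For each dimension $d$ let $n=n(d)$, with $n,d\to\infty$ and $n/d\to\delta\in(0,\infty)$. Let $q:\mathbb R^2\to\mathbb R$ be a known link function, $P_\varepsilon$ a distribution on $\mathbb R$ with finite second moment, and $\alpha\in(1/2,1)$. The signals $x_1^*,x_2^*$ are independent and uniform on the unit sphere $\mathbb S^{d-1}$; the covariates $a_1,\dots,a_n$ are i.i.d. $\mathcal N(0,I_d)$; the latent variables $\eta_1,\dots,\eta_n$ are i.i.d. Bernoulli$(\alpha)$; the noise variables $\varepsilon_1,\dots,\varepsilon_n$ are i.i.d. $P_\varepsilon$; all of these are mutually independent. The observations are $y_i=q(\langle a_i,\eta_ix_1^*+(1-\eta_i)x_2^*\rangle,\varepsilon_i)$, $i=1,\dots,n$. Let $(G,\varepsilon)\sim\mathcal N(0,1)\otimes P_\varepsilon$ and $Y=q(G,\varepsilon)$. $\mathrm{supp}(X)$ denotes the support of the density of a random variable $X$. For fixed $g\in\mathbb R$, $p(\cdot|g)$ denotes the distribution of $q(g,\varepsilon)$, $\varepsilon\sim P_\varepsilon$, written as a density in $y$ (so $\mathbb E[G^kp(y|G)]$ is the density at $y$ of the measure $B\mapsto\mathbb E[G^k\mathbf 1\{Y\in B\}]$). Parameters attached to a preprocessing function $\mathcal T:\mathbb R\to\mathbb R$. Put $Z=\mathcal T(Y)$, $\delta_1=\alpha\delta$, $\delta_2=(1-\alpha)\delta$. For $\lambda>\sup\mathrm{supp}(Z)$ and $\Delta>0$, $$\phi(\lambda)=\lambda\,\mathbb E\Big[\frac{ZG^2}{\lambda-Z}\Big],\qquad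 \psi(\lambda;\Delta)=\lambda\Big(\frac1\Delta+\mathbb E\Big[\frac Z{\lambda-Z}\Big]\Big),$$ $\bar\lambda(\Delta)=\operatorname{argmin}_{\lambda>\sup\mathrm{supp}(Z)}\psi(\lambda;\Delta)$, $\zeta(\lambda;\Delta)=\psi(\max\{\lambda,\bar\lambda(\Delta)\};\Delta)$, and for $i\in\{1,2\}$, $\lambda^*(\delta_i)$ is the unique solution $\lambda\in(\sup\mathrm{supp}(Z),\infty)$ of $\zeta(\lambda;\delta_i)=\phi(\lambda)$. With $\alpha_1=\alpha,\alpha_2=1-\alpha$, let $$\rho_i^{\mathrm{spec}}=\left(\frac{\frac1\delta-\mathbb E\big[\big(\frac Z{\lambda^*(\delta_i)-Z}\big)^2\big]}{\frac1\delta+\alpha_i\,\mathbb E\big[\big(\frac Z{\lambda^*(\delta_i)-Z}\big)^2(G^2-1)\big]}\right)^{1/2}$$ (the asymptotic overlap with $x_i^*$ of the $i$-th leading eigenvector of $\frac1n\sum_j\mathcal T(y_j)a_ja_j^\top$ when $\lambda^*(\delta_i)>\bar\lambda(\delta)$). Optimality notions. For $i\in\{1,2\}$ and $\delta\in(0,\infty)$, $\mathcal H_i$ (which depends on $\delta$) is the set of Lipschitz functions $\mathcal T:\mathbb R\to\mathbb R$ with $\inf_{y\in\mathrm{supp}(Y)}\mathcal T(y)>-\infty$, $0<\sup_{y\in\mathrm{supp}(Y)}\mathcal T(y)<\infty$, $\mathbb P(\mathcal T(Y)=0)<1$ and $\lambda^*(\delta_i)>\bar\lambda(\delta)$. The spectral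 threshold is $\delta_i^{\mathrm{spec}}=\inf\{\delta\in(0,\infty):\mathcal H_i\ne\emptyset\}$, and for $\delta>\delta_i^{\mathrm{spec}}$ the optimal overlap is $\mathsf{OL}_i^{\mathrm{spec}}=\sup_{\mathcal T\in\mathcal H_i}\rho_i^{\mathrm{spec}}$. "Achieved by $\mathcal T_i^*$" means that $\rho_i^{\mathrm{spec}}$ evaluated at $\mathcal T=\mathcal T_i^*$ equals $\mathsf{OL}_i^{\mathrm{spec}}$. Conventions: $1/0=+\infty$ and $\inf\emptyset=+\infty$.
   Formalization: In (i), membership of T_i^* in H_i is asserted only if T_i^* (or an a.e.-equal version) is Lipschitz, which fails e.g. for q(g,ε)=g^4; its other conditions and (ii) hold always. Where the argmin is not attained, λ-bar is set to sup supp(Z). *)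

theory Defs
  imports "HOL-Probability.Probability"
begin

text \<open>
  Everything depends on the link function and the noise only through the joint law of
  \<open>(G, Y)\<close>. Below, \<open>M\<close> stands for that law, so \<open>G\<close> is \<open>fst\<close>, \<open>Y\<close> is \<open>snd\<close> and the
  preprocessed variable \<open>Z\<close> is \<open>\<lambda>x. T (snd x)\<close>.
\<close>

definition law_GY :: "(real \<times> real \<Rightarrow> real) \<Rightarrow> real measure \<Rightarrow> (real \<times> real) measure" where
  "law_GY q Peps =
     distr (density lborel (\<lambda>x. ennreal (std_normal_density x)) \<Otimes>\<^sub>M Peps)
       (borel \<Otimes>\<^sub>M borel) (\<lambda>(g, e). (g, q (g, e)))"

definition law_Y :: "(real \<times> real) measure \<Rightarrow> real measure" where
  "law_Y M = distr M borel snd"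

definition law_Z :: "(real \<times> real) measure \<Rightarrow> (real \<Rightarrow> real) \<Rightarrow> real measure" where
  "law_Z M T = distr M borel (\<lambda>x. T (snd x))"

text \<open>
  The support is the topological support of the law. This does not depend on the version of
  a density, and it also makes sense for \<open>Z\<close>, which need not have a density.
\<close>

definition supp :: "real measure \<Rightarrow> real set" where
  "supp \<mu> = {x. \<forall>U. open U \<and> x \<in> U \<longrightarrow> emeasure \<mu> U > 0}"

text \<open>
  \<open>moment_density M k f\<close> says that \<open>f y\<close> is (a version of) \<open>E[G\<^sup>k p(y|G)]\<close>, i.e. that \<open>f\<close> is a
  Lebesgue density of the measure \<open>B \<mapsto> E[G\<^sup>k 1{Y \<in> B}]\<close>. The conditional laws \<open>p(\<cdot>|g)\<close>
  themselves need not have densities, so noiseless models are covered.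
\<close>

definition moment_density :: "(real \<times> real) measure \<Rightarrow> nat \<Rightarrow> (real \<Rightarrow> real) \<Rightarrow> bool" where
  "moment_density M k f \<longleftrightarrow>
     f \<in> borel_measurable borel \<and>
     (\<forall>B\<in>sets borel.
        set_integrable lborel B f \<and>
        (LINT y:B|lborel. f y) = (LINT x|M. fst x ^ k * indicator B (snd x)))"

definition sup_supp_Z :: "(real \<times> real) measure \<Rightarrow> (real \<Rightarrow> real) \<Rightarrow> real" where
  "sup_supp_Z M T = Sup (supp (law_Z M T))"

definition phi :: "(real \<times> real) measure \<Rightarrow> (real \<Rightarrow> real) \<Rightarrow> real \<Rightarrow> real" where
  "phi M T l = l * (LINT x|M. T (snd x) * (fst x)\<^sup>2 / (l - T (snd x)))"

definition psi :: "(real \<times> real) measure \<Rightarrow> (real \<Rightarrow> real) \<Rightarrow> real \<Rightarrow> real \<Rightarrow> real" where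
  "psi M T \<Delta> l = l * (1 / \<Delta> + (LINT x|M. T (snd x) / (l - T (snd x))))"

text \<open>
  For \<open>Z\<close> bounded and not almost surely zero, \<open>psi\<close> is strictly convex and tends to infinity
  at infinity, so its minimiser over \<open>(sup supp Z, \<infinity>)\<close> is unique if it exists. It fails to exist
  exactly if \<open>psi\<close> is strictly increasing on that interval; the infimum is then approached at
  the left end point, which is taken as the value of \<open>lam_bar\<close>.
\<close>

definition lam_bar :: "(real \<times> real) measure \<Rightarrow> (real \<Rightarrow> real) \<Rightarrow> real \<Rightarrow> real" where
  "lam_bar M T \<Delta> =
     (if \<exists>l. is_arg_min (psi M T \<Delta>) (\<lambda>l. l > sup_supp_Z M T) l
      then arg_min (psi M T \<Delta>) (\<lambda>l. l > sup_supp_Z M T)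
      else sup_supp_Z M T)"

definition zeta :: "(real \<times> real) measure \<Rightarrow> (real \<Rightarrow> real) \<Rightarrow> real \<Rightarrow> real \<Rightarrow> real" where
  "zeta M T \<Delta> l = psi M T \<Delta> (max l (lam_bar M T \<Delta>))"

definition is_lam_star :: "(real \<times> real) measure \<Rightarrow> (real \<Rightarrow> real) \<Rightarrow> real \<Rightarrow> real \<Rightarrow> bool" where
  "is_lam_star M T \<Delta> l \<longleftrightarrow> l > sup_supp_Z M T \<and> zeta M T \<Delta> l = phi M T l"

definition lam_star :: "(real \<times> real) measure \<Rightarrow> (real \<Rightarrow> real) \<Rightarrow> real \<Rightarrow> real" where
  "lam_star M T \<Delta> = (THE l. is_lam_star M T \<Delta> l)"

text \<open>In what follows \<open>a\<close> is the weight \<open>\<alpha>\<^sub>i\<close> of the \<open>i\<close>-th signal, so that \<open>\<delta>\<^sub>i = a * \<delta>\<close>.\<close>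

definition weight :: "real \<Rightarrow> nat \<Rightarrow> real" where
  "weight \<alpha> i = (if i = 1 then \<alpha> else 1 - \<alpha>)"

definition rho_spec :: "(real \<times> real) measure \<Rightarrow> real \<Rightarrow> real \<Rightarrow> (real \<Rightarrow> real) \<Rightarrow> real" where
  "rho_spec M a \<delta> T =
     (let l = lam_star M T (a * \<delta>) in
      sqrt ((1 / \<delta> - (LINT x|M. (T (snd x) / (l - T (snd x)))\<^sup>2)) /
            (1 / \<delta> + a * (LINT x|M. (T (snd x) / (l - T (snd x)))\<^sup>2 * ((fst x)\<^sup>2 - 1)))))"

text \<open>
  \<open>admissible\<close> collects the requirements on a preprocessing function other than being Lipschitz.
  The condition \<open>\<lambda>\<^sup>*(\<delta>\<^sub>i) > \<lambda>\<close>-bar\<open>(\<delta>)\<close> includes that \<open>\<lambda>\<^sup>*(\<delta>\<^sub>i)\<close> is well defined.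
\<close>

definition admissible :: "(real \<times> real) measure \<Rightarrow> real \<Rightarrow> real \<Rightarrow> (real \<Rightarrow> real) \<Rightarrow> bool" where
  "admissible M a \<delta> T \<longleftrightarrow>
     bdd_below (T ` supp (law_Y M)) \<and>
     bdd_above (T ` supp (law_Y M)) \<and>
     0 < (SUP y\<in>supp (law_Y M). T y) \<and>
     measure M {x \<in> space M. T (snd x) = 0} < 1 \<and>
     (\<exists>!l. is_lam_star M T (a * \<delta>) l) \<and>
     lam_star M T (a * \<delta>) > lam_bar M T \<delta>"

definition lipschitz :: "(real \<Rightarrow> real) \<Rightarrow> bool" where
  "lipschitz T \<longleftrightarrow> (\<exists>L. L-lipschitz_on UNIV T)"

definition H_class :: "(real \<times> real) measure \<Rightarrow> real \<Rightarrow> real \<Rightarrow> (real \<Rightarrow> real) set" where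
  "H_class M a \<delta> = {T. lipschitz T \<and> admissible M a \<delta> T}"

definition spec_threshold :: "(real \<times> real) measure \<Rightarrow> real \<Rightarrow> ennreal" where
  "spec_threshold M a = Inf {ennreal \<delta> | \<delta>. 0 < \<delta> \<and> H_class M a \<delta> \<noteq> {}}"

definition OL_spec :: "(real \<times> real) measure \<Rightarrow> real \<Rightarrow> real \<Rightarrow> ereal" where
  "OL_spec M a \<delta> = (SUP T\<in>H_class M a \<delta>. ereal (rho_spec M a \<delta> T))"

text \<open>
  From here on \<open>m0 y\<close> and \<open>m2 y\<close> are versions of \<open>E[p(y|G)]\<close> and \<open>E[p(y|G) G\<^sup>2]\<close>, so
  \<open>E[p(y|G) (G\<^sup>2 - 1)]\<close> is \<open>m2 y - m0 y\<close>. On \<open>{m0 = 0}\<close>, where also \<open>m2 = 0\<close> almost everywhere,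
  the quotients are zero by the convention \<open>x / 0 = 0\<close>.
\<close>

definition is_beta_star ::
  "(real \<times> real) measure \<Rightarrow> (real \<Rightarrow> real) \<Rightarrow> (real \<Rightarrow> real) \<Rightarrow> real \<Rightarrow> real \<Rightarrow> real \<Rightarrow> bool" where
  "is_beta_star M m0 m2 a \<delta> \<beta> \<longleftrightarrow>
     \<beta> > 1 - a \<and>
     (\<beta> - (1 - a)) *
       (LINT y:supp (law_Y M)|lborel. (m2 y - m0 y)\<^sup>2 / (a * m2 y + \<beta> * m0 y))
     = 1 / (a\<^sup>2 * \<delta>)"

definition T_star :: "(real \<Rightarrow> real) \<Rightarrow> (real \<Rightarrow> real) \<Rightarrow> real \<Rightarrow> real \<Rightarrow> real" where
  "T_star m0 m2 a y = 1 - 1 / (a * (m2 y / m0 y) + (1 - a))"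

end

theory Submission
  imports Defs
begin

text \<open>
  Write \<open>R = m2 / m0 = E[G\<^sup>2 | Y]\<close>, so that \<open>E[R] = 1\<close>, and let \<open>w = Z / (\<lambda>\<^sup>* - Z)\<close> be the resolvent of a
  preprocessing function at its spectral parameter. Everything is determined by moments of \<open>w\<close>. The
  function \<open>psi\<close> is convex with derivative \<open>1 / \<Delta> - E[Z\<^sup>2 / (\<lambda> - Z)\<^sup>2]\<close> and \<open>phi\<close> is nonincreasing. So for bounded
  \<open>Z\<close> with a positive value in its support, \<open>\<lambda>\<^sup>*(a \<delta>)\<close> exists, is unique and exceeds \<open>\<lambda>\<close>-bar\<open>(\<delta>)\<close> if
  and only if there is a parameter \<open>\<lambda>\<^sup>*\<close> beyond the support of \<open>Z\<close> with
  \<open>E[w (R - 1)] = 1 / (a \<delta>)\<close> and \<open>E[w\<^sup>2] < 1 / \<delta>\<close> (lemma \<open>lam_star_iff_moments\<close>).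

  Now the optimisation is over \<open>w\<close>. The Cauchy-Schwarz inequality
  \<open>E[w (R - 1)]\<^sup>2 \<le> E[w\<^sup>2] E[(R - 1)\<^sup>2]\<close> turns the two conditions into \<open>1 / (a\<^sup>2 \<delta>) < E[(R - 1)\<^sup>2]\<close>, which is
  \<open>\<delta>\<close> being above the claimed threshold (\<open>detection_bound\<close>). With the weight \<open>a R + \<beta>\<close> instead, and with
  \<open>\<beta>\<close> solving the fixed point equation, Cauchy-Schwarz becomes
  \<open>E[w\<^sup>2 (a R + \<beta>)] \<ge> (\<beta> - (1 - a)) / \<delta>\<close>, a rearrangement of \<open>\<rho>\<^sup>2 \<le> 1 / (\<beta> + a)\<close> (\<open>overlap_bound\<close>).
  Equality holds for \<open>w\<close> proportional to \<open>(R - 1) / (a R + \<beta>)\<close>, and this is the resolvent of \<open>T_star\<close> at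
  \<open>\<lambda> = 1 + 1 / (\<beta> - (1 - a))\<close> (\<open>T_star_resolvent\<close>, \<open>AE_T_star_optimal\<close>).

  Solvability of the fixed point equation is the intermediate value theorem: its left-hand side
  increases from \<open>0\<close> at \<open>\<beta> = 1 - a\<close> to \<open>E[(R - 1)\<^sup>2]\<close> at infinity (\<open>beta_star_exists\<close>,
  \<open>beta_star_unique\<close>).

  The supremum and the threshold only range over Lipschitz functions, to which \<open>T_star\<close> need not
  belong. So above the threshold the optimal resolvent is approximated by Lipschitz functions, rescaled
  to satisfy the spectral equation (\<open>H_class_approximates_opt\<close>). This shows at once that the class is
  nonempty and that the bound is its supremum.
\<close>

section \<open>Topological supports of laws on the line\<close>

lemma closed_supp: "closed (supp \<mu>)"
proof -
  have "- supp \<mu> = \<Union>{U. open U \<and> emeasure \<mu> U = 0}"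
    by (auto simp: supp_def zero_less_iff_neq_zero)
  then have "open (- supp \<mu>)" by (metis (no_types, lifting) mem_Collect_eq open_Union)
  then show ?thesis by (simp add: closed_def)
qed

lemma supp_sets[measurable]: "supp \<mu> \<in> sets borel"
  using closed_supp by (rule borel_closed)

text \<open>The complement of the support is a union of open null sets, and by the Lindelof property
  countably many of them suffice.\<close>
lemma AE_in_supp:
  assumes "sets \<mu> = sets borel"
  shows "AE y in \<mu>. y \<in> supp \<mu>"
proof -
  let ?F = "{U::real set. open U \<and> emeasure \<mu> U = 0}"
  obtain F' where F': "F' \<subseteq> ?F" "countable F'" "\<Union>F' = \<Union>?F"
    by (rule Lindelof[of ?F]) auto
  have "\<Union>F' \<in> null_sets \<mu>"
  proof -
    have "(\<Union>U\<in>F'. U) \<in> null_sets \<mu>"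
      using F' assms by (intro null_sets_UN') (auto simp: null_sets_def)
    then show ?thesis by simp
  qed
  moreover have "{y \<in> space \<mu>. y \<notin> supp \<mu>} \<subseteq> \<Union>F'"
    unfolding F'(3) by (auto simp: supp_def zero_less_iff_neq_zero)
  ultimately show ?thesis by (rule AE_I')
qed

text \<open>A closed constraint that holds almost surely holds at every point of the support. This turns
  almost sure bounds on a Lipschitz function of \<open>Y\<close> into the pointwise bounds asked for by \<open>admissible\<close>.\<close>
lemma supp_in_closed:
  assumes "sets \<mu> = sets borel" "AE y in \<mu>. f y \<in> C" "closed C" "continuous_on UNIV f"
    and y: "y \<in> supp \<mu>"
  shows "f y \<in> C"
proof (rule ccontr)
  assume "f y \<notin> C"
  have op: "open (f -` (- C))" using assms by (intro open_vimage) auto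
  then have "emeasure \<mu> (f -` (- C)) > 0" using y \<open>f y \<notin> C\<close> by (auto simp: supp_def)
  moreover have "emeasure \<mu> (f -` (- C)) = 0"
  proof -
    have "f -` (- C) \<in> sets \<mu>" using op assms(1) by auto
    then show ?thesis using assms(2)
      by (subst AE_iff_measurable[symmetric, where P = "\<lambda>y. f y \<in> C"])
        (auto simp: sets_eq_imp_space_eq[OF assms(1)])
  qed
  ultimately show False by simp
qed

section \<open>Integrals depending on a parameter\<close>

lemma continuous_on_integral_dominated:
  fixes f :: "'t::metric_space \<Rightarrow> 'b \<Rightarrow> real"
  assumes m: "\<And>t. t \<in> S \<Longrightarrow> f t \<in> borel_measurable M"
    and c: "AE x in M. continuous_on S (\<lambda>t. f t x)"
    and b: "\<And>t. t \<in> S \<Longrightarrow> AE x in M. \<bar>f t x\<bar> \<le> w x" and w: "integrable M w"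
  shows "continuous_on S (\<lambda>t. LINT x|M. f t x)"
  unfolding continuous_on_sequentially
proof (intro allI ballI impI)
  fix t u assume t: "t \<in> S" and u: "(\<forall>n. u n \<in> S) \<and> u \<longlonglongrightarrow> t"
  show "((\<lambda>t. LINT x|M. f t x) \<circ> u) \<longlonglongrightarrow> (LINT x|M. f t x)"
    unfolding comp_def
  proof (rule integral_dominated_convergence[OF _ _ w])
    show "f t \<in> borel_measurable M" "\<And>i. f (u i) \<in> borel_measurable M" using m t u by auto
    show "AE x in M. (\<lambda>i. f (u i) x) \<longlonglongrightarrow> f t x"
      using c by (rule AE_mp) (use t u in \<open>auto simp: continuous_on_sequentially comp_def\<close>)
    show "\<And>i. AE x in M. norm (f (u i) x) \<le> w x" using b u by auto
  qed
qed

section \<open>Almost everywhere approximation by Lipschitz functions\<close>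

lemma lipschitz_imp_continuous: "lipschitz T \<Longrightarrow> continuous_on UNIV T"
  unfolding lipschitz_def using lipschitz_on_continuous_on by blast

lemma lipschitz_imp_measurable: "lipschitz T \<Longrightarrow> T \<in> borel_measurable borel"
  by (intro borel_measurable_continuous_onI lipschitz_imp_continuous)

lemma lipschitz_min_max:
  assumes "L-lipschitz_on UNIV (f :: real \<Rightarrow> real)"
  shows "L-lipschitz_on UNIV (\<lambda>y. max lo (min hi (f y)))"
proof (rule lipschitz_onI)
  show "0 \<le> L" using assms by (rule lipschitz_on_nonneg)
  fix x y :: real
  have "dist (f x) (f y) \<le> L * dist x y" using assms by (auto dest: lipschitz_onD)
  then show "dist (max lo (min hi (f x))) (max lo (min hi (f y))) \<le> L * dist x y"
    by (auto simp: dist_real_def)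
qed

text \<open>Polynomials are Lipschitz on compact intervals, and composing with the projection onto the
  interval extends this to the line.\<close>
lemma continuous_approx_lipschitz:
  fixes g :: "real \<Rightarrow> real"
  assumes g: "continuous_on UNIV g" and e: "e > 0"
  shows "\<exists>h. lipschitz h \<and> (\<forall>y\<in>{-b..b}. \<bar>g y - h y\<bar> < e)"
proof -
  obtain p where p: "real_polynomial_function p" "\<And>x. x \<in> {-b..b} \<Longrightarrow> \<bar>g x - p x\<bar> < e"
    using Stone_Weierstrass_real_polynomial_function[of "{-b..b}" g e] e g
    by (metis compact_Icc continuous_on_subset subset_UNIV)
  obtain p' where p': "real_polynomial_function p'" "\<And>x. (p has_real_derivative p' x) (at x)"
    using has_real_derivative_polynomial_function[OF p(1)] by auto
  have "compact (p' ` {-b..b})"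
    by (intro compact_continuous_image continuous_on_polymonial_function)
      (use p' in \<open>auto simp: real_polynomial_function_eq\<close>)
  then obtain B where B: "\<And>x. x \<in> {-b..b} \<Longrightarrow> \<bar>p' x\<bar> \<le> B"
    by (meson bounded_real compact_imp_bounded imageI)
  have lip: "\<bar>p x - p y\<bar> \<le> max B 0 * \<bar>x - y\<bar>" if "x \<in> {-b..b}" "y \<in> {-b..b}" for x y
    using field_differentiable_bound[of "{-b..b}" p p' "max B 0" x y] that B p'(2)
    by (fastforce simp: has_field_derivative_at_within)
  define h where "h y = p (max (-b) (min b y))" for y
  show ?thesis
  proof (cases "b < 0")
    case True
    then show ?thesis by (intro exI[of _ "\<lambda>_. 0"]) (auto simp: lipschitz_def lipschitz_on_def)
  next
    case False
    have "(max B 0)-lipschitz_on UNIV h"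
    proof (rule lipschitz_onI)
      fix x y :: real
      have "\<bar>h x - h y\<bar> \<le> max B 0 * \<bar>max (-b) (min b x) - max (-b) (min b y)\<bar>"
        unfolding h_def using False by (intro lip) auto
      also have "\<dots> \<le> max B 0 * \<bar>x - y\<bar>" by (intro mult_left_mono) auto
      finally show "dist (h x) (h y) \<le> max B 0 * dist x y" by (simp add: dist_real_def)
    qed auto
    moreover have "\<bar>g y - h y\<bar> < e" if "y \<in> {-b..b}" for y
      using p(2)[OF that] that by (simp add: h_def)
    ultimately show ?thesis by (auto simp: lipschitz_def)
  qed
qed

text \<open>A measurable function is almost everywhere the limit of continuous ones; these are uniformly
  close to polynomials on growing intervals, and clamping the argument and the value keeps the
  approximants Lipschitz and inside the range of the limit.\<close>
lemma lipschitz_approx_AE: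
  fixes f :: "real \<Rightarrow> real"
  assumes f: "f \<in> borel_measurable borel" and r: "\<And>y. lo \<le> f y \<and> f y \<le> hi"
  obtains F :: "nat \<Rightarrow> real \<Rightarrow> real" where
    "\<And>n. lipschitz (F n)" "\<And>n y. lo \<le> F n y \<and> F n y \<le> hi"
    "AE y in lborel. (\<lambda>n. F n y) \<longlonglongrightarrow> f y"
proof -
  have "f \<in> borel_measurable (lebesgue_on UNIV)"
    using measurable_completion[of f lborel borel] f by simp
  then have "f measurable_on UNIV"
    by (subst measurable_on_iff_borel_measurable) auto
  then obtain N g where N: "negligible N" and g: "\<And>n. continuous_on UNIV (g n)"
    and lim: "\<And>x. x \<notin> N \<Longrightarrow> (\<lambda>n::nat. g n x) \<longlonglongrightarrow> f x"
    by (auto simp: measurable_on_def)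
  have "\<exists>h. \<forall>n. lipschitz (h n) \<and> (\<forall>y\<in>{-real n..real n}. \<bar>g n y - h n y\<bar> < inverse (real (Suc n)))"
    using continuous_approx_lipschitz[OF g] by (intro choice) (simp del: of_nat_Suc)
  then obtain h where h: "\<And>n. lipschitz (h n)"
    "\<And>n y. y \<in> {-real n..real n} \<Longrightarrow> \<bar>g n y - h n y\<bar> < inverse (real (Suc n))" by blast
  have hlim: "(\<lambda>n. h n y) \<longlonglongrightarrow> f y" if "y \<notin> N" for y
  proof -
    have "(\<lambda>n. g n y - h n y) \<longlonglongrightarrow> 0"
    proof (rule Lim_null_comparison[OF _ LIMSEQ_inverse_real_of_nat])
      show "\<forall>\<^sub>F n in sequentially. norm (g n y - h n y) \<le> inverse (real (Suc n))"
        using eventually_ge_at_top[of "nat \<lceil>\<bar>y\<bar>\<rceil>"]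
      proof eventually_elim
        case (elim n)
        then have "y \<in> {-real n..real n}" by auto
        then show ?case using h(2)[of y n] by (simp del: of_nat_Suc)
      qed
    qed
    from tendsto_diff[OF lim[OF that] this] show ?thesis by simp
  qed
  show ?thesis
  proof
    fix n show "lipschitz (\<lambda>y. max lo (min hi (h n y)))"
      using h(1)[of n] unfolding lipschitz_def by (auto intro: lipschitz_min_max)
    fix y show "lo \<le> max lo (min hi (h n y)) \<and> max lo (min hi (h n y)) \<le> hi"
      using r[of y] by auto
  next
    have "AE y in lborel. y \<notin> N"
    proof -
      have "N \<in> null_sets lebesgue" using N by (simp add: negligible_iff_null_sets)
      then have "AE y in lebesgue. y \<notin> N" by (rule AE_not_in)
      then show ?thesis by (simp add: AE_completion_iff)
    qed
    then show "AE y in lborel. (\<lambda>n. max lo (min hi (h n y))) \<longlonglongrightarrow> f y"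
    proof eventually_elim
      case (elim y)
      have "(\<lambda>n. max lo (min hi (h n y))) \<longlonglongrightarrow> max lo (min hi (f y))"
        by (intro tendsto_intros hlim elim)
      moreover have "max lo (min hi (f y)) = f y" using r[of y] by auto
      ultimately show ?case by (simp only:)
    qed
  qed
qed

section \<open>The parameters of a preprocessing function\<close>

locale joint_law = prob_space M for M :: "(real \<times> real) measure" +
  assumes sets_M: "sets M = sets (borel \<Otimes>\<^sub>M borel)"
    and integrable_G2: "integrable M (\<lambda>x. (fst x)\<^sup>2)"
    and expectation_G2: "(LINT x|M. (fst x)\<^sup>2) = 1"
begin

lemma measurable_fst_M[measurable]: "fst \<in> borel_measurable M"
  and measurable_snd_M[measurable]: "snd \<in> borel_measurable M"
  by (simp_all add: measurable_cong_sets[OF sets_M refl])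

lemma integrable_bounded:
  assumes [measurable]: "h \<in> borel_measurable M" and "AE x in M. \<bar>h x\<bar> \<le> C"
  shows "integrable M h" and "integrable M (\<lambda>x. h x * (fst x)\<^sup>2)"
    and "integrable M (\<lambda>x. h x * ((fst x)\<^sup>2 - 1))"
proof -
  show 1: "integrable M h"
    using assms by (intro integrable_const_bound[where B=C]) auto
  show 2: "integrable M (\<lambda>x. h x * (fst x)\<^sup>2)"
  proof (rule Bochner_Integration.integrable_bound)
    show "integrable M (\<lambda>x. C * (fst x)\<^sup>2)" using integrable_G2 by simp
    show "AE x in M. norm (h x * (fst x)\<^sup>2) \<le> norm (C * (fst x)\<^sup>2)"
      using assms(2) by eventually_elim (auto simp: abs_mult intro!: mult_right_mono)
  qed simp
  show "integrable M (\<lambda>x. h x * ((fst x)\<^sup>2 - 1))"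
    using Bochner_Integration.integrable_diff[OF 2 1] by (simp add: right_diff_distrib)
qed

end

text \<open>An admissible function is bounded on the support of \<open>Y\<close> only, which gives an almost sure bound.
  Almost sure statements are also what allows functions that agree up to null sets to be exchanged.\<close>
locale preprocessed = joint_law +
  fixes T :: "real \<Rightarrow> real" and B :: real
  assumes T_measurable[measurable]: "T \<in> borel_measurable borel"
    and T_bounded: "AE x in M. \<bar>T (snd x)\<bar> \<le> B"
    and T_nonzero: "\<not> (AE x in M. T (snd x) = 0)"
begin

abbreviation "s \<equiv> sup_supp_Z M T"

lemma AE_supp_law_Z: "AE x in M. T (snd x) \<in> supp (law_Z M T)"
proof -
  have "AE z in law_Z M T. z \<in> supp (law_Z M T)"
    by (rule AE_in_supp) (simp add: law_Z_def)
  then show ?thesis unfolding law_Z_def by (subst (asm) AE_distr_iff) auto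
qed

lemma supp_law_Z_le:
  assumes "AE x in M. T (snd x) \<le> b" and "z \<in> supp (law_Z M T)" shows "z \<le> b"
proof -
  have "AE z in law_Z M T. z \<in> {..b}"
    unfolding law_Z_def using assms(1) by (subst AE_distr_iff) auto
  from supp_in_closed[where f = "\<lambda>z. z", OF _ this _ _ assms(2)] show ?thesis
    by (simp add: law_Z_def)
qed

lemma bdd_above_supp_law_Z: "bdd_above (supp (law_Z M T))"
proof (rule bdd_aboveI)
  fix z assume "z \<in> supp (law_Z M T)"
  then show "z \<le> B" by (rule supp_law_Z_le[rotated]) (use T_bounded in \<open>auto elim: eventually_mono\<close>)
qed

lemma AE_le_sup_supp_Z: "AE x in M. T (snd x) \<le> s"
  using AE_supp_law_Z
  by eventually_elim (auto simp: sup_supp_Z_def intro: cSup_upper bdd_above_supp_law_Z)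

lemma sup_supp_Z_le:
  assumes "AE x in M. T (snd x) \<le> b" shows "s \<le> b"
proof -
  have "supp (law_Z M T) \<noteq> {}"
  proof
    assume "supp (law_Z M T) = {}"
    then have "AE x in M. False" using AE_supp_law_Z by simp
    then show False by (simp add: AE_False)
  qed
  then show ?thesis unfolding sup_supp_Z_def
    by (rule cSup_least) (rule supp_law_Z_le[OF assms])
qed

lemma sup_supp_Z_pos:
  assumes "\<not> (AE x in M. T (snd x) \<le> 0)" shows "s > 0"
proof (rule ccontr)
  assume "\<not> s > 0"
  then have "AE x in M. T (snd x) \<le> 0" using AE_le_sup_supp_Z by (auto elim: eventually_mono)
  with assms show False by simp
qed

lemma resolvent_bound:
  assumes "l > s"
  shows "AE x in M. \<bar>T (snd x) / (l - T (snd x))\<bar> \<le> B / (l - s)"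
  using AE_le_sup_supp_Z T_bounded
proof eventually_elim
  case (elim x)
  then show ?case using assms by (auto simp: abs_divide intro!: frac_le)
qed

text \<open>The derivative of \<open>psi\<close> at \<open>l\<close> is \<open>1 / \<Delta> - second_moment l\<close>, and its slope between \<open>l\<close> and \<open>m\<close>
  is \<open>1 / \<Delta> - cross l m\<close>.\<close>
abbreviation "second_moment l \<equiv> (LINT x|M. (T (snd x) / (l - T (snd x)))\<^sup>2)"

abbreviation "cross l m \<equiv> (LINT x|M. (T (snd x) / (l - T (snd x))) * (T (snd x) / (m - T (snd x))))"

lemma cross_bound:
  assumes "l > s" "m > s"
  shows "AE x in M. \<bar>(T (snd x) / (l - T (snd x))) * (T (snd x) / (m - T (snd x)))\<bar>
      \<le> (B / (l - s)) * (B / (m - s))"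
  using resolvent_bound[OF assms(1)] resolvent_bound[OF assms(2)]
  by eventually_elim (auto simp only: abs_mult intro!: mult_mono)

lemma square_bound:
  assumes "l > s"
  shows "AE x in M. \<bar>(T (snd x) / (l - T (snd x)))\<^sup>2\<bar> \<le> (B / (l - s))\<^sup>2"
  using cross_bound[OF assms assms] by (simp add: power2_eq_square)

lemma cross_integrable:
  assumes "l > s" "m > s"
  shows "integrable M (\<lambda>x. (T (snd x) / (l - T (snd x))) * (T (snd x) / (m - T (snd x))))"
  by (rule integrable_bounded(1)[OF _ cross_bound[OF assms]]) simp

lemma resolvent_diff:
  fixes z l m :: real
  assumes "z < l" "z < m"
  shows "l * (z / (l - z)) - m * (z / (m - z)) = (m - l) * ((z / (l - z)) * (z / (m - z)))"
  using assms by (simp add: field_simps)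

text \<open>The difference quotients of \<open>psi\<close> and \<open>phi\<close> are explicit, which replaces differentiating
  under the integral.\<close>
lemma psi_diff:
  assumes "l > s" "m > s"
  shows "psi M T \<Delta> l - psi M T \<Delta> m = (l - m) * (1 / \<Delta> - cross l m)"
proof -
  have i: "integrable M (\<lambda>x. l * (T (snd x) / (l - T (snd x))))" if "l > s" for l
    by (intro integrable_mult_right integrable_bounded(1)[OF _ resolvent_bound[OF that]]) simp
  have "l * (LINT x|M. T (snd x) / (l - T (snd x))) - m * (LINT x|M. T (snd x) / (m - T (snd x)))
     = (LINT x|M. l * (T (snd x) / (l - T (snd x))) - m * (T (snd x) / (m - T (snd x))))"
    by (simp only: Bochner_Integration.integral_diff[OF i[OF assms(1)] i[OF assms(2)]]
        integral_mult_right_zero)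
  also have "\<dots> = (LINT x|M. (m - l) * ((T (snd x) / (l - T (snd x))) * (T (snd x) / (m - T (snd x)))))"
  proof (rule integral_cong_AE)
    show "AE x in M. l * (T (snd x) / (l - T (snd x))) - m * (T (snd x) / (m - T (snd x)))
      = (m - l) * ((T (snd x) / (l - T (snd x))) * (T (snd x) / (m - T (snd x))))"
      using AE_le_sup_supp_Z by eventually_elim (use assms in \<open>intro resolvent_diff; simp\<close>)
  qed auto
  also have "\<dots> = (m - l) * cross l m" by (rule integral_mult_right_zero)
  finally have eq: "l * (LINT x|M. T (snd x) / (l - T (snd x))) - m * (LINT x|M. T (snd x) / (m - T (snd x)))
    = (m - l) * cross l m" .
  have "l * e - m * f = (m - l) * c \<Longrightarrow> l * (p + e) - m * (p + f) = (l - m) * (p - c)" for p e f c :: real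
    by algebra
  from this[OF eq] show ?thesis unfolding psi_def .
qed

lemma phi_antimono:
  assumes "l > s" "l \<le> m"
  shows "phi M T m \<le> phi M T l"
proof -
  have m: "m > s" using assms by simp
  have i: "integrable M (\<lambda>x. l * (T (snd x) / (l - T (snd x)) * (fst x)\<^sup>2))" if "l > s" for l
    by (intro integrable_mult_right integrable_bounded(2)[OF _ resolvent_bound[OF that]]) simp
  have "(LINT x|M. m * (T (snd x) / (m - T (snd x)) * (fst x)\<^sup>2))
      \<le> (LINT x|M. l * (T (snd x) / (l - T (snd x)) * (fst x)\<^sup>2))"
  proof (rule integral_mono_AE[OF i[OF m] i[OF assms(1)]])
    show "AE x in M. m * (T (snd x) / (m - T (snd x)) * (fst x)\<^sup>2)
      \<le> l * (T (snd x) / (l - T (snd x)) * (fst x)\<^sup>2)"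
      using AE_le_sup_supp_Z
    proof eventually_elim
      case (elim x)
      have "0 \<le> (m - l) * ((T (snd x) / (l - T (snd x))) * (T (snd x) / (m - T (snd x))))"
        using elim assms by (simp add: zero_le_mult_iff zero_le_divide_iff)
      then have "m * (T (snd x) / (m - T (snd x))) \<le> l * (T (snd x) / (l - T (snd x)))"
        using resolvent_diff[of "T (snd x)" l m] elim assms by linarith
      from mult_right_mono[OF this, of "(fst x)\<^sup>2"] show ?case by (simp add: mult.assoc)
    qed
  qed
  then show ?thesis by (simp only: phi_def integral_mult_right_zero times_divide_eq_left)
qed

text \<open>This is convexity of \<open>psi\<close>: the slope between two points lies between the derivatives there. It is
  strict because \<open>Z\<close> is not almost surely zero.\<close>
lemma
  assumes "l > s" "l \<le> m"
  shows second_moment_le_cross: "second_moment m \<le> cross l m"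
    and cross_le_second_moment: "cross l m \<le> second_moment l"
    and second_moment_less_cross: "l < m \<Longrightarrow> second_moment m < cross l m"
proof -
  have m: "m > s" using assms by simp
  have pw: "AE x in M. (T (snd x) / (m - T (snd x)))\<^sup>2
        \<le> (T (snd x) / (l - T (snd x))) * (T (snd x) / (m - T (snd x)))
     \<and> (T (snd x) / (l - T (snd x))) * (T (snd x) / (m - T (snd x))) \<le> (T (snd x) / (l - T (snd x)))\<^sup>2
     \<and> (l < m \<and> T (snd x) \<noteq> 0 \<longrightarrow> (T (snd x) / (m - T (snd x)))\<^sup>2
        \<noteq> (T (snd x) / (l - T (snd x))) * (T (snd x) / (m - T (snd x))))"
    using AE_le_sup_supp_Z
  proof eventually_elim
    case (elim x)
    let ?z = "T (snd x)"
    have 1: "1 / (m - ?z) \<le> 1 / (l - ?z)" "0 < 1 / (m - ?z)" using elim assms by (auto intro!: divide_left_mono)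
    have "?z\<^sup>2 * (1 / (m - ?z) * (1 / (m - ?z))) \<le> ?z\<^sup>2 * (1 / (l - ?z) * (1 / (m - ?z)))"
      "?z\<^sup>2 * (1 / (l - ?z) * (1 / (m - ?z))) \<le> ?z\<^sup>2 * (1 / (l - ?z) * (1 / (l - ?z)))"
      using 1 elim assms by (intro mult_left_mono mult_right_mono; simp)+
    then have "(?z / (m - ?z))\<^sup>2 \<le> (?z / (l - ?z)) * (?z / (m - ?z))
        \<and> (?z / (l - ?z)) * (?z / (m - ?z)) \<le> (?z / (l - ?z))\<^sup>2"
      by (simp add: power2_eq_square)
    moreover have "(?z / (m - ?z))\<^sup>2 \<noteq> (?z / (l - ?z)) * (?z / (m - ?z))" if "l < m" "?z \<noteq> 0"
      using that elim assms by (auto simp: power2_eq_square)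
    ultimately show ?case by blast
  qed
  note i = cross_integrable[OF assms(1) m] cross_integrable[OF m m] cross_integrable[OF assms(1) assms(1)]
  show "second_moment m \<le> cross l m"
    using pw by (intro integral_mono_AE) (use i in \<open>auto simp: power2_eq_square elim: eventually_mono\<close>)
  show "cross l m \<le> second_moment l"
    using pw by (intro integral_mono_AE) (use i in \<open>auto simp: power2_eq_square elim: eventually_mono\<close>)
  show "second_moment m < cross l m" if "l < m"
  proof (rule integral_less_AE[where A = "{x\<in>space M. T (snd x) \<noteq> 0}"])
    show "emeasure M {x \<in> space M. T (snd x) \<noteq> 0} \<noteq> 0"
      using T_nonzero by (subst (asm) AE_iff_measurable[OF _ refl]) auto
  qed (use pw i that in \<open>auto simp: power2_eq_square elim: eventually_mono\<close>)
qed

lemma continuous_second_moment: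
  assumes "l0 > s" shows "continuous_on {l0..} second_moment"
proof (rule continuous_on_integral_dominated)
  show "integrable M (\<lambda>_. (B / (l0 - s))\<^sup>2)" by simp
  show "AE x in M. \<bar>(T (snd x) / (l - T (snd x)))\<^sup>2\<bar> \<le> (B / (l0 - s))\<^sup>2" if "l \<in> {l0..}" for l
    using AE_le_sup_supp_Z T_bounded
  proof eventually_elim
    case (elim x)
    then have "\<bar>T (snd x) / (l - T (snd x))\<bar> \<le> B / (l0 - s)"
      using assms that by (auto simp: abs_divide intro!: frac_le)
    from power_mono[OF this, of 2] show ?case by (simp add: power_divide)
  qed
  show "AE x in M. continuous_on {l0..} (\<lambda>l. (T (snd x) / (l - T (snd x)))\<^sup>2)"
    using AE_le_sup_supp_Z by eventually_elim (use assms in \<open>auto intro!: continuous_intros\<close>)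
qed simp

lemma psi_strict_mono:
  assumes "l > s" "l < m" "second_moment l < 1 / \<Delta>"
  shows "psi M T \<Delta> l < psi M T \<Delta> m"
proof -
  have "(m - l) * (1 / \<Delta> - cross m l) > 0"
    using cross_le_second_moment[of l m] assms by (intro mult_pos_pos) (auto simp: mult.commute)
  then show ?thesis using psi_diff[of m l \<Delta>] assms by simp
qed

text \<open>\<open>second_moment l < 1 / \<Delta>\<close> says that \<open>psi\<close> has a positive derivative at \<open>l\<close>. By convexity this
  means that \<open>l\<close> lies strictly to the right of the minimiser.\<close>
lemma lam_bar_less:
  assumes l: "l > s" and g: "second_moment l < 1 / \<Delta>"
  shows "lam_bar M T \<Delta> < l"
proof (cases "\<exists>l. is_arg_min (psi M T \<Delta>) (\<lambda>l. l > s) l")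
  case True
  define l0 where "l0 = arg_min (psi M T \<Delta>) (\<lambda>l. l > s)"
  have l0: "is_arg_min (psi M T \<Delta>) (\<lambda>l. l > s) l0"
    using True unfolding l0_def arg_min_def by (rule someI_ex)
  have "\<exists>\<mu>. s < \<mu> \<and> \<mu> < l \<and> second_moment \<mu> < 1 / \<Delta>"
  proof -
    let ?c = "(s + l) / 2"
    have "continuous_on {?c..} second_moment" using l by (intro continuous_second_moment) simp
    then have "isCont second_moment l"
      using l by (intro continuous_on_interior[of "{?c..}"]) (auto simp: interior_real_atLeast)
    then have "\<forall>\<^sub>F \<mu> in at l. second_moment \<mu> < 1 / \<Delta>"
      using g by (intro order_tendstoD(2)) (auto simp: isCont_def)
    then have "\<forall>\<^sub>F \<mu> in at_left l. second_moment \<mu> < 1 / \<Delta>"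
      by (rule filter_leD[OF at_le, rotated]) simp
    moreover have "\<forall>\<^sub>F \<mu> in at_left l. \<mu> \<in> {s<..<l}"
      using l by (intro eventually_at_leftI[of s]) auto
    ultimately have "\<forall>\<^sub>F \<mu> in at_left l. second_moment \<mu> < 1 / \<Delta> \<and> \<mu> \<in> {s<..<l}"
      by (rule eventually_conj)
    then show ?thesis by (auto dest!: eventually_happens)
  qed
  then obtain \<mu> where \<mu>: "s < \<mu>" "\<mu> < l" "second_moment \<mu> < 1 / \<Delta>" by blast
  have "l0 \<le> \<mu>"
  proof (rule ccontr)
    assume "\<not> l0 \<le> \<mu>"
    then have "psi M T \<Delta> \<mu> < psi M T \<Delta> l0" using \<mu> by (intro psi_strict_mono) auto
    then show False using l0 \<mu> by (auto simp: is_arg_min_def)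
  qed
  then show ?thesis using True \<mu> by (simp add: lam_bar_def l0_def)
next
  case False
  then show ?thesis using l unfolding lam_bar_def by (simp only: if_False)
qed

text \<open>The converse of the previous lemma. If it failed, \<open>second_moment\<close>, which is continuous and vanishes
  at infinity, would take the value \<open>1 / \<Delta>\<close> at some \<open>l1 \<ge> l\<close>. Such an \<open>l1\<close> is a minimiser of \<open>psi\<close>, and
  by strict convexity no minimiser can lie to the left of it.\<close>
lemma second_moment_less:
  assumes \<Delta>: "\<Delta> > 0" and l: "l > s" "l > lam_bar M T \<Delta>"
  shows "second_moment l < 1 / \<Delta>"
proof (rule ccontr)
  assume "\<not> second_moment l < 1 / \<Delta>"
  then have ge: "1 / \<Delta> \<le> second_moment l" by simp
  have "((\<lambda>m. (B / (m - s))\<^sup>2) \<longlongrightarrow> 0) at_top"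
  proof -
    have "filterlim (\<lambda>m. - s + m) at_top at_top"
      by (rule filterlim_tendsto_add_at_top[OF tendsto_const filterlim_ident])
    then have "((\<lambda>m. B / (m - s)) \<longlongrightarrow> 0) at_top"
      by (intro tendsto_divide_0[OF tendsto_const] filterlim_at_top_imp_at_infinity) simp
    from tendsto_power[OF this, of 2] show ?thesis by simp
  qed
  then have "\<forall>\<^sub>F m in at_top. (B / (m - s))\<^sup>2 < 1 / \<Delta>" by (rule order_tendstoD(2)) (use \<Delta> in simp)
  from eventually_happens[OF eventually_conj[OF this eventually_ge_at_top[of l]]]
  obtain m where m: "(B / (m - s))\<^sup>2 < 1 / \<Delta>" "m \<ge> l" by auto
  have "second_moment m \<le> (LINT x|M. (B / (m - s))\<^sup>2)"
    using square_bound[of m] m l cross_integrable[of m m]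
    by (intro integral_mono_AE) (auto simp: power2_eq_square)
  also have "\<dots> < 1 / \<Delta>" using m by (simp add: prob_space)
  finally have lt: "second_moment m \<le> 1 / \<Delta>" by simp
  have "continuous_on {l..m} second_moment"
    by (rule continuous_on_subset[OF continuous_second_moment[OF l(1)]]) auto
  from IVT2'[OF lt ge m(2) this] obtain l1 where l1: "l \<le> l1" "second_moment l1 = 1 / \<Delta>" by auto
  have "l1 > s" using l l1 by simp
  have min1: "is_arg_min (psi M T \<Delta>) (\<lambda>l. l > s) l1"
    unfolding is_arg_min_def
  proof (intro conjI notI)
    show "s < l1" by fact
    assume "\<exists>y. s < y \<and> psi M T \<Delta> y < psi M T \<Delta> l1"
    then obtain y where y: "s < y" "psi M T \<Delta> y < psi M T \<Delta> l1" by blast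
    have "0 \<le> (y - l1) * (1 / \<Delta> - cross y l1)"
    proof (cases "y \<le> l1")
      case True
      then show ?thesis using second_moment_le_cross[of y l1] y l1
        by (intro mult_nonpos_nonpos) auto
    next
      case False
      then show ?thesis using cross_le_second_moment[of l1 y] \<open>l1 > s\<close> l1
        by (intro mult_nonneg_nonneg) (auto simp: mult.commute)
    qed
    then show False using psi_diff[of y l1 \<Delta>] y \<open>l1 > s\<close> by simp
  qed
  define l0 where "l0 = arg_min (psi M T \<Delta>) (\<lambda>l. l > s)"
  have l0: "is_arg_min (psi M T \<Delta>) (\<lambda>l. l > s) l0"
    unfolding l0_def arg_min_def using min1 by (rule someI)
  have "lam_bar M T \<Delta> = l0" using min1 by (auto simp: lam_bar_def l0_def)
  then have "l0 < l1" using l l1 by simp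
  moreover have "l0 > s" using l0 by (simp add: is_arg_min_def)
  ultimately have "(l1 - l0) * (1 / \<Delta> - cross l1 l0) < 0"
    using second_moment_less_cross[of l0 l1] l1
    by (intro mult_pos_neg) (auto simp: mult.commute)
  then have "psi M T \<Delta> l1 < psi M T \<Delta> l0" using psi_diff[of l1 l0 \<Delta>] \<open>l1 > s\<close> \<open>l0 > s\<close> by simp
  then show False using l0 \<open>l1 > s\<close> by (auto simp: is_arg_min_def)
qed

text \<open>\<open>zeta\<close> is flat up to the minimiser and follows the increasing branch of \<open>psi\<close> from there on. If \<open>l\<close>
  is on the flat part, the minimiser is attained, and the midpoint \<open>?p\<close> separates it from \<open>m\<close>, since
  the derivative bound is only available strictly to the right of the minimiser.\<close>
lemma zeta_strict_mono:
  assumes \<Delta>: "\<Delta> > 0" and l: "l > s" "l < m" "lam_bar M T \<Delta> < m"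
  shows "zeta M T \<Delta> l < zeta M T \<Delta> m"
proof (cases "lam_bar M T \<Delta> < l")
  case True
  then show ?thesis using psi_strict_mono[OF l(1,2) second_moment_less[OF \<Delta>]] l by (simp add: zeta_def)
next
  case False
  let ?b = "lam_bar M T \<Delta>" and ?p = "(lam_bar M T \<Delta> + m) / 2"
  have "\<exists>l. is_arg_min (psi M T \<Delta>) (\<lambda>l. l > s) l"
    using False l by (auto simp: lam_bar_def split: if_splits)
  then have "is_arg_min (psi M T \<Delta>) (\<lambda>l. l > s) ?b"
    unfolding lam_bar_def by (simp add: arg_min_def someI_ex)
  then have "psi M T \<Delta> ?b \<le> psi M T \<Delta> ?p"
    using False l by (auto simp: is_arg_min_def not_less field_simps dest!: spec[of _ ?p])
  also have "\<dots> < psi M T \<Delta> m"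
    using False l by (intro psi_strict_mono second_moment_less \<Delta>) auto
  finally show ?thesis using False l by (simp add: zeta_def max_def)
qed

lemma psi_eq_phi_iff:
  assumes l: "l > s" "l > 0"
  shows "psi M T \<Delta> l = phi M T l
    \<longleftrightarrow> (LINT x|M. T (snd x) / (l - T (snd x)) * ((fst x)\<^sup>2 - 1)) = 1 / \<Delta>"
proof -
  note i = integrable_bounded[OF _ resolvent_bound[OF l(1)]]
  have "(LINT x|M. T (snd x) / (l - T (snd x)) * ((fst x)\<^sup>2 - 1))
    = (LINT x|M. T (snd x) / (l - T (snd x)) * (fst x)\<^sup>2) - (LINT x|M. T (snd x) / (l - T (snd x)))"
    using i(1,2) by (subst Bochner_Integration.integral_diff[symmetric]) (auto simp: right_diff_distrib)
  then show ?thesis using l by (auto simp: psi_def phi_def)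
qed

text \<open>If \<open>l\<close> lies to the right of \<open>lam_bar\<close>, then \<open>zeta\<close> is strictly below \<open>zeta l\<close> before \<open>l\<close> and strictly
  above it after \<open>l\<close>, while \<open>phi\<close> is nonincreasing.\<close>
lemma is_lam_star_unique:
  assumes \<Delta>: "\<Delta> > 0" and l: "is_lam_star M T \<Delta> l" "lam_bar M T \<Delta> < l" and m: "is_lam_star M T \<Delta> m"
  shows "m = l"
proof (rule ccontr)
  assume "m \<noteq> l"
  then consider "m < l" | "l < m" by linarith
  then show False
  proof cases
    case 1
    then show False using zeta_strict_mono[OF \<Delta>, of m l] phi_antimono[of m l] l m
      by (auto simp: is_lam_star_def)
  next
    case 2
    then show False using zeta_strict_mono[OF \<Delta>, of l m] phi_antimono[of l m] l m
      by (auto simp: is_lam_star_def)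
  qed
qed

text \<open>Since \<open>a < 1\<close>, the minimiser for \<open>a * \<delta>\<close> lies to the left of the one for \<open>\<delta>\<close>. So \<open>zeta\<close> is \<open>psi\<close>
  at \<open>l\<close>, and the conditions on \<open>l\<close> only involve moments of \<open>Z / (l - Z)\<close>.\<close>
lemma lam_star_iff_moments:
  assumes d: "\<delta> > 0" "0 < a" "a < 1" and s: "s > 0"
  shows "(\<exists>!l. is_lam_star M T (a * \<delta>) l) \<and> lam_star M T (a * \<delta>) = l \<and> lam_bar M T \<delta> < l
    \<longleftrightarrow> l > s \<and> (LINT x|M. T (snd x) / (l - T (snd x)) * ((fst x)\<^sup>2 - 1)) = 1 / (a * \<delta>)
        \<and> second_moment l < 1 / \<delta>" (is "?L \<longleftrightarrow> ?R")
proof -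
  have ad: "a * \<delta> > 0" "1 / \<delta> < 1 / (a * \<delta>)" using d by (auto simp: field_simps)
  have key: "lam_bar M T (a * \<delta>) < l" if "l > s" "second_moment l < 1 / \<delta>"
    using that ad by (intro lam_bar_less) auto
  show ?thesis
  proof
    assume L: ?L
    then have st: "is_lam_star M T (a * \<delta>) l" using theI'[of "is_lam_star M T (a * \<delta>)"]
      by (auto simp: lam_star_def)
    then have "l > s" by (simp add: is_lam_star_def)
    moreover from this have g: "second_moment l < 1 / \<delta>" using L d by (intro second_moment_less) auto
    moreover have "psi M T (a * \<delta>) l = phi M T l"
      using st key[OF \<open>l > s\<close> g] by (simp add: is_lam_star_def zeta_def)
    ultimately show ?R using psi_eq_phi_iff[of l "a * \<delta>"] s by auto
  next
    assume R: ?R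
    then have b: "lam_bar M T (a * \<delta>) < l" using key by simp
    then have st: "is_lam_star M T (a * \<delta>) l"
      using R psi_eq_phi_iff[of l "a * \<delta>"] s by (auto simp: is_lam_star_def zeta_def)
    then have "\<exists>!l. is_lam_star M T (a * \<delta>) l" using is_lam_star_unique[OF ad(1) st b] by blast
    moreover from this have "lam_star M T (a * \<delta>) = l"
      unfolding lam_star_def using st by (rule the1_equality)
    moreover have "lam_bar M T \<delta> < l" using R by (intro lam_bar_less) auto
    ultimately show ?L by simp
  qed
qed

end

section \<open>Conditioning on the observation\<close>

context joint_law
begin

text \<open>The law of \<open>Y\<close> under the measure \<open>G\<^sup>k dM\<close> has density \<open>f\<close>. As measures, rather than set by set,
  this carries over to all functions of \<open>Y\<close>.\<close>
lemma distr_moment_density: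
  assumes f: "moment_density M k f" "\<And>y. 0 \<le> f y"
    and k: "even k" and i: "integrable M (\<lambda>x. fst x ^ k)"
  shows "distr (density M (\<lambda>x. ennreal (fst x ^ k))) borel snd = density lborel (\<lambda>y. ennreal (f y))"
proof (rule measure_eqI)
  fix B assume "B \<in> sets (distr (density M (\<lambda>x. ennreal (fst x ^ k))) borel snd)"
  then have B[measurable]: "B \<in> sets borel" by simp
  have f_m[measurable]: "f \<in> borel_measurable borel" using f by (simp add: moment_density_def)
  have fB: "set_integrable lborel B f"
    "(LINT y:B|lborel. f y) = (LINT x|M. fst x ^ k * indicator B (snd x))"
    using f(1) B by (auto simp: moment_density_def)
  have "emeasure (distr (density M (\<lambda>x. ennreal (fst x ^ k))) borel snd) B
      = (\<integral>\<^sup>+x. ennreal (fst x ^ k) * indicator (snd -` B \<inter> space M) x \<partial>M)"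
    by (subst emeasure_distr) (auto simp: emeasure_density)
  also have "\<dots> = (\<integral>\<^sup>+x. ennreal (fst x ^ k * indicator B (snd x)) \<partial>M)"
    by (intro nn_integral_cong) (auto simp: indicator_def)
  also have "\<dots> = ennreal (LINT x|M. fst x ^ k * indicator B (snd x))"
  proof (rule nn_integral_eq_integral)
    show "integrable M (\<lambda>x. fst x ^ k * indicator B (snd x))"
      using i by (rule Bochner_Integration.integrable_bound) (auto simp: indicator_def)
    show "AE x in M. 0 \<le> fst x ^ k * (indicator B (snd x) :: real)"
      using k by (auto simp: indicator_def zero_le_even_power)
  qed
  also have "\<dots> = ennreal (LINT y|lborel. indicator B y * f y)"
    using fB(2) by (simp add: set_lebesgue_integral_def)
  also have "\<dots> = (\<integral>\<^sup>+y. ennreal (indicator B y * f y) \<partial>lborel)"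
    using fB(1) f(2) by (intro nn_integral_eq_integral[symmetric]) (auto simp: set_integrable_def)
  also have "\<dots> = emeasure (density lborel (\<lambda>y. ennreal (f y))) B"
    by (subst emeasure_density) (auto intro!: nn_integral_cong simp: indicator_def)
  finally show "emeasure (distr (density M (\<lambda>x. ennreal (fst x ^ k))) borel snd) B
    = emeasure (density lborel (\<lambda>y. ennreal (f y))) B" .
qed simp

lemma
  fixes h :: "real \<Rightarrow> real"
  assumes f: "moment_density M k f" "\<And>y. 0 \<le> f y"
    and k: "even k" and i: "integrable M (\<lambda>x. fst x ^ k)"
    and h[measurable]: "h \<in> borel_measurable borel"
  shows integrable_moment_density:
      "integrable M (\<lambda>x. h (snd x) * fst x ^ k) \<longleftrightarrow> integrable lborel (\<lambda>y. h y * f y)" (is ?A)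
    and integral_moment_density:
      "(LINT x|M. h (snd x) * fst x ^ k) = (LINT y|lborel. h y * f y)" (is ?B)
proof -
  note eq = distr_moment_density[OF f k i]
  have f_m[measurable]: "f \<in> borel_measurable borel" using f by (simp add: moment_density_def)
  have nn: "AE x in M. 0 \<le> fst x ^ k" using k by (simp add: zero_le_even_power)
  have "integrable M (\<lambda>x. fst x ^ k *\<^sub>R h (snd x))
    \<longleftrightarrow> integrable (distr (density M (\<lambda>x. ennreal (fst x ^ k))) borel snd) h"
    by (subst integrable_distr_eq) (auto simp: integrable_density nn)
  also have "\<dots> \<longleftrightarrow> integrable lborel (\<lambda>y. f y *\<^sub>R h y)"
    unfolding eq using f(2) by (subst integrable_density) auto
  finally show ?A by (simp add: mult.commute)
  have "(LINT x|M. fst x ^ k *\<^sub>R h (snd x))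
    = integral\<^sup>L (distr (density M (\<lambda>x. ennreal (fst x ^ k))) borel snd) h"
    by (subst integral_distr) (auto simp: integral_density nn)
  also have "\<dots> = (LINT y|lborel. f y *\<^sub>R h y)"
    unfolding eq using f(2) by (subst integral_density) auto
  finally show ?B by (simp add: mult.commute)
qed

end

locale spectral_model = joint_law +
  fixes m0 m2 :: "real \<Rightarrow> real" and a :: real
  assumes m0: "moment_density M 0 m0" "\<And>y. 0 \<le> m0 y"
    and m2: "moment_density M 2 m2" "\<And>y. 0 \<le> m2 y"
    and a: "0 < a" "a < 1"
begin

lemma m_measurable[measurable]: "m0 \<in> borel_measurable borel" "m2 \<in> borel_measurable borel"
  using m0 m2 by (auto simp: moment_density_def)

lemma
  assumes [measurable]: "h \<in> borel_measurable borel"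
  shows integrable_m0: "integrable M (\<lambda>x. h (snd x)) \<longleftrightarrow> integrable lborel (\<lambda>y. h y * m0 y)"
    and integral_m0: "(LINT x|M. h (snd x)) = (LINT y|lborel. h y * m0 y)"
    and integrable_m2: "integrable M (\<lambda>x. h (snd x) * (fst x)\<^sup>2) \<longleftrightarrow> integrable lborel (\<lambda>y. h y * m2 y)"
    and integral_m2: "(LINT x|M. h (snd x) * (fst x)\<^sup>2) = (LINT y|lborel. h y * m2 y)"
  using integrable_moment_density[OF m0, of h] integral_moment_density[OF m0, of h]
    integrable_moment_density[OF m2 _ integrable_G2, of h] integral_moment_density[OF m2 _ integrable_G2, of h]
  by simp_all

lemma integrable_m: "integrable lborel m0" "integrable lborel m2"
  and integral_m: "(LINT y|lborel. m0 y) = 1" "(LINT y|lborel. m2 y) = 1"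
  using integrable_m0[of "\<lambda>_. 1"] integral_m0[of "\<lambda>_. 1"] integrable_m2[of "\<lambda>_. 1"]
    integral_m2[of "\<lambda>_. 1"] integrable_G2 expectation_G2 by (simp_all add: prob_space)

lemma law_Y_eq_density: "law_Y M = density lborel (\<lambda>y. ennreal (m0 y))"
  using distr_moment_density[OF m0] by (simp add: law_Y_def density_1)

lemma AE_law_Y_iff:
  assumes [measurable]: "Measurable.pred borel P"
  shows "(AE x in M. P (snd x)) \<longleftrightarrow> (AE y in lborel. m0 y \<noteq> 0 \<longrightarrow> P y)"
proof -
  have "(AE x in M. P (snd x)) \<longleftrightarrow> (AE y in law_Y M. P y)"
    unfolding law_Y_def by (subst AE_distr_iff) auto
  also have "\<dots> \<longleftrightarrow> (AE y in lborel. m0 y \<noteq> 0 \<longrightarrow> P y)"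
  proof -
    have "m0 y \<noteq> 0 \<longleftrightarrow> 0 < m0 y" for y using m0(2)[of y] by linarith
    then show ?thesis unfolding law_Y_eq_density by (subst AE_density) auto
  qed
  finally show ?thesis .
qed

lemma AE_in_supp_law_Y: "AE y in lborel. m0 y \<noteq> 0 \<longrightarrow> y \<in> supp (law_Y M)"
proof -
  have "AE y in law_Y M. y \<in> supp (law_Y M)" by (rule AE_in_supp) (simp add: law_Y_def)
  then have "AE x in M. snd x \<in> supp (law_Y M)"
    unfolding law_Y_def by (subst (asm) AE_distr_iff) auto
  then show ?thesis by (subst (asm) AE_law_Y_iff) auto
qed

text \<open>\<open>Y\<close> almost surely avoids the zero set of \<open>m0\<close>, so \<open>G\<^sup>2\<close> has integral zero over the event
  \<open>m0 Y = 0\<close>. This is what makes the convention \<open>x / 0 = 0\<close> harmless in the quotients below.\<close>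
lemma AE_m2_eq_0: "AE y in lborel. m0 y = 0 \<longrightarrow> m2 y = 0"
proof -
  let ?h = "\<lambda>y. indicator {y. m0 y = 0} y :: real"
  have "AE x in M. m0 (snd x) \<noteq> 0" by (subst AE_law_Y_iff) auto
  then have "(LINT x|M. ?h (snd x) * (fst x)\<^sup>2) = 0"
    by (intro integral_eq_zero_AE) (auto elim: eventually_mono)
  then have z: "(LINT y|lborel. ?h y * m2 y) = 0" by (subst (asm) integral_m2) auto
  have "integrable lborel (\<lambda>y. ?h y * m2 y)"
    using integrable_m(2) by (rule Bochner_Integration.integrable_bound) (auto simp: indicator_def)
  then have "AE y in lborel. ?h y * m2 y = 0"
    using z by (subst (asm) integral_nonneg_eq_0_iff_AE) (auto simp: m2)
  then show ?thesis by eventually_elim (auto simp: indicator_def)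
qed

section \<open>The fixed point equation\<close>

text \<open>With \<open>R = m2 / m0 = E[G\<^sup>2 | Y]\<close>, the integral of \<open>chi2 \<beta>\<close> is \<open>E[(R - 1)\<^sup>2 / (a R + \<beta>)]\<close> and \<open>V\<close> is the
  variance of \<open>R\<close>, which may be infinite.\<close>
abbreviation "chi2 \<beta> y \<equiv> (m2 y - m0 y)\<^sup>2 / (a * m2 y + \<beta> * m0 y)"

abbreviation "V \<equiv> (\<integral>\<^sup>+y. ennreal ((m2 y - m0 y)\<^sup>2 / m0 y) \<partial>lborel)"

lemma set_integral_supp:
  assumes [measurable]: "f \<in> borel_measurable borel" and f: "\<And>y. m0 y = 0 \<Longrightarrow> m2 y = 0 \<Longrightarrow> f y = 0"
  shows "(LINT y:supp (law_Y M)|lborel. f y) = (LINT y|lborel. f y :: real)"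
  unfolding set_lebesgue_integral_def
proof (rule integral_cong_AE)
  show "AE y in lborel. indicator (supp (law_Y M)) y *\<^sub>R f y = f y"
    using AE_in_supp_law_Y AE_m2_eq_0
    by eventually_elim (use f in \<open>auto simp: indicator_def\<close>)
qed auto

lemma set_nn_integral_supp:
  "(\<integral>\<^sup>+y\<in>supp (law_Y M). ennreal ((m2 y - m0 y)\<^sup>2 / m0 y) \<partial>lborel) = V"
proof (rule nn_integral_cong_AE)
  show "AE y in lborel. ennreal ((m2 y - m0 y)\<^sup>2 / m0 y) * indicator (supp (law_Y M)) y
    = ennreal ((m2 y - m0 y)\<^sup>2 / m0 y)"
    using AE_in_supp_law_Y by eventually_elim (auto simp: indicator_def)
qed

lemma is_beta_star_iff:
  "is_beta_star M m0 m2 a \<delta> \<beta> \<longleftrightarrow>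
    \<beta> > 1 - a \<and> (LINT y|lborel. (\<beta> - (1 - a)) * chi2 \<beta> y) = 1 / (a\<^sup>2 * \<delta>)"
  by (simp add: is_beta_star_def set_integral_supp del: times_divide_eq_right)

text \<open>For \<open>\<beta> \<ge> 1 - a\<close> the denominator dominates \<open>m2 + m0\<close>. So \<open>chi2 \<beta>\<close> grows only linearly in \<open>R\<close> and
  is integrable even if \<open>V\<close> is infinite.\<close>
lemma denominator_ge:
  assumes "1 - a \<le> \<beta>" shows "min a (1 - a) * (m2 y + m0 y) \<le> a * m2 y + \<beta> * m0 y"
proof -
  have "min a (1 - a) * m2 y \<le> a * m2 y" "min a (1 - a) * m0 y \<le> \<beta> * m0 y"
    using assms m0(2)[of y] m2(2)[of y] by (auto intro!: mult_right_mono)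
  then show ?thesis by (simp add: algebra_simps)
qed

lemma chi2_bounds:
  assumes "1 - a \<le> \<beta>" shows "0 \<le> chi2 \<beta> y" "chi2 \<beta> y \<le> (m2 y + m0 y) / min a (1 - a)"
proof -
  note n = m0(2)[of y] m2(2)[of y]
  show "0 \<le> chi2 \<beta> y" using assms a n by auto
  show "chi2 \<beta> y \<le> (m2 y + m0 y) / min a (1 - a)"
  proof (cases "m2 y + m0 y = 0")
    case True
    then have "m2 y = 0" "m0 y = 0" using n by linarith+
    then show ?thesis by simp
  next
    case False
    then have p: "m2 y + m0 y > 0" using n by linarith
    have q: "min a (1 - a) > 0" using a by simp
    have "(m2 y - m0 y)\<^sup>2 \<le> (m2 y + m0 y)\<^sup>2" using n by (intro power2_le_iff_abs_le[THEN iffD2]) auto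
    then have "chi2 \<beta> y \<le> (m2 y + m0 y)\<^sup>2 / (min a (1 - a) * (m2 y + m0 y))"
      using p q denominator_ge[OF assms, of y] by (intro frac_le) auto
    also have "\<dots> = (m2 y + m0 y) / min a (1 - a)" using p q by (simp add: power2_eq_square)
    finally show ?thesis .
  qed
qed

lemma chi2_integrable:
  assumes "1 - a \<le> \<beta>" shows "integrable lborel (chi2 \<beta>)"
proof (rule Bochner_Integration.integrable_bound)
  show "integrable lborel (\<lambda>y. (m2 y + m0 y) / min a (1 - a))" using integrable_m by simp
  show "AE y in lborel. norm (chi2 \<beta> y) \<le> norm ((m2 y + m0 y) / min a (1 - a))"
  proof (rule AE_I2)
    fix y show "norm (chi2 \<beta> y) \<le> norm ((m2 y + m0 y) / min a (1 - a))"
      using chi2_bounds[OF assms, of y] unfolding real_norm_def by linarith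
  qed
qed simp

text \<open>Monotonicity in \<open>\<beta>\<close> is read off from this factorisation, including when it is strict.\<close>
lemma scaled_chi2_diff:
  assumes "1 - a \<le> \<beta>" "1 - a \<le> \<gamma>"
  shows "(\<gamma> - (1 - a)) * chi2 \<gamma> y - (\<beta> - (1 - a)) * chi2 \<beta> y
    = (\<gamma> - \<beta>) * (chi2 \<beta> y * ((a * m2 y + (1 - a) * m0 y) / (a * m2 y + \<gamma> * m0 y)))"
proof (cases "m2 y = 0 \<and> m0 y = 0")
  case False
  then have "m2 y + m0 y > 0" using m0(2)[of y] m2(2)[of y] by linarith
  then have "min a (1 - a) * (m2 y + m0 y) > 0" using a by simp
  then have p: "a * m2 y + \<beta> * m0 y > 0" "a * m2 y + \<gamma> * m0 y > 0"
    using denominator_ge[OF assms(1), of y] denominator_ge[OF assms(2), of y] by linarith+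
  have "(g - c) * (n / q) - (b - c) * (n / p) = (g - b) * (n / p * ((u + c * v) / q))"
    if "p = u + b * v" "q = u + g * v" "p > 0" "q > 0" for b c g n p q u v :: real
  proof -
    have "(g - c) * (n / q) - (b - c) * (n / p) = n * ((g - c) * p - (b - c) * q) / (p * q)"
      using that(3,4) by (simp add: field_simps)
    also have "(g - c) * p - (b - c) * q = (g - b) * (u + c * v)"
      unfolding that(1,2) by algebra
    finally show ?thesis using that(3,4) by (simp add: mult_ac)
  qed
  from this[OF refl refl p] show ?thesis .
qed simp

lemma scaled_chi2_mono:
  assumes "1 - a \<le> \<beta>" "\<beta> \<le> \<gamma>"
  shows "(\<beta> - (1 - a)) * chi2 \<beta> y \<le> (\<gamma> - (1 - a)) * chi2 \<gamma> y"
proof -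
  have "0 \<le> (\<gamma> - \<beta>) * (chi2 \<beta> y * ((a * m2 y + (1 - a) * m0 y) / (a * m2 y + \<gamma> * m0 y)))"
    using assms a m0(2)[of y] m2(2)[of y]
    by (intro mult_nonneg_nonneg divide_nonneg_nonneg add_nonneg_nonneg chi2_bounds) auto
  then show ?thesis using scaled_chi2_diff[of \<beta> \<gamma> y] assms by linarith
qed

text \<open>Two solutions would give the same integral to two ordered integrands, which then agree almost
  everywhere. By the factorisation above this forces \<open>chi2 \<beta> = 0\<close>, but \<open>1 / (a\<^sup>2 \<delta>)\<close> is positive.\<close>
lemma beta_star_unique:
  assumes "is_beta_star M m0 m2 a \<delta> \<beta>" "is_beta_star M m0 m2 a \<delta> \<gamma>" "\<delta> > 0"
  shows "\<beta> = \<gamma>"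
proof -
  have "\<not> \<beta> < \<gamma>" if b: "is_beta_star M m0 m2 a \<delta> \<beta>" "is_beta_star M m0 m2 a \<delta> \<gamma>" for \<beta> \<gamma>
  proof
    assume lt: "\<beta> < \<gamma>"
    have g: "1 - a < \<beta>" "1 - a < \<gamma>" using b by (auto simp: is_beta_star_iff)
    let ?f = "\<lambda>y. (\<gamma> - (1 - a)) * chi2 \<gamma> y - (\<beta> - (1 - a)) * chi2 \<beta> y"
    have i: "integrable lborel (\<lambda>y. (\<gamma> - (1 - a)) * chi2 \<gamma> y)" "integrable lborel (\<lambda>y. (\<beta> - (1 - a)) * chi2 \<beta> y)"
      using g chi2_integrable by (auto intro!: integrable_mult_right simp del: times_divide_eq_right)
    have "(LINT y|lborel. ?f y) = 0" using i b by (simp only: Bochner_Integration.integral_diff is_beta_star_iff)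
    then have "AE y in lborel. ?f y = 0"
      using i g lt scaled_chi2_mono[of \<beta> \<gamma>]
      by (subst (asm) integral_nonneg_eq_0_iff_AE) (auto simp del: times_divide_eq_right)
    then have "AE y in lborel. (\<beta> - (1 - a)) * chi2 \<beta> y = 0"
    proof eventually_elim
      case (elim y)
      then have z: "chi2 \<beta> y = 0 \<or> a * m2 y + (1 - a) * m0 y = 0 \<or> a * m2 y + \<gamma> * m0 y = 0"
        using scaled_chi2_diff[of \<beta> \<gamma> y] g lt by (auto simp del: times_divide_eq_right)
      have "m2 y = 0 \<and> m0 y = 0" if "a * m2 y + \<kappa> * m0 y = 0" "\<kappa> > 0" for \<kappa>
      proof -
        have "0 \<le> a * m2 y" "0 \<le> \<kappa> * m0 y" using a that m0(2)[of y] m2(2)[of y] by auto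
        then have "a * m2 y = 0" "\<kappa> * m0 y = 0" using that by linarith+
        then show ?thesis using a that by simp
      qed
      from this[of "1 - a"] this[of \<gamma>] z have "chi2 \<beta> y = 0" using a g by auto
      then show ?case by (simp only: mult_zero_right)
    qed
    then have "(LINT y|lborel. (\<beta> - (1 - a)) * chi2 \<beta> y) = 0" by (rule integral_eq_zero_AE)
    then show False using b(1) a \<open>\<delta> > 0\<close> by (simp add: is_beta_star_iff)
  qed
  from this[OF assms(1,2)] this[OF assms(2,1)] show ?thesis by simp
qed

text \<open>By Fatou's lemma the left-hand side of the fixed point equation reaches every level below \<open>V\<close>;
  it vanishes at the left end point and is continuous.\<close>
lemma beta_star_exists:
  assumes d: "\<delta> > 0" and V: "ennreal (1 / (a\<^sup>2 * \<delta>)) < V"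
  shows "\<exists>\<beta>. is_beta_star M m0 m2 a \<delta> \<beta>"
proof -
  let ?c = "1 - a"
  let ?F = "\<lambda>\<beta>. LINT y|lborel. (\<beta> - ?c) * chi2 \<beta> y"
  let ?x = "1 / (a\<^sup>2 * \<delta>)"
  have x: "?x > 0" using a d by simp
  have "\<exists>n. ?F (1 + real n) \<ge> ?x"
  proof (rule ccontr)
    assume "\<nexists>n. ?F (1 + real n) \<ge> ?x"
    then have lt: "?F (1 + real n) < ?x" for n by (simp add: not_le del: times_divide_eq_right)
    have pt: "ennreal ((m2 y - m0 y)\<^sup>2 / m0 y)
        = liminf (\<lambda>n. ennreal ((1 + real n - ?c) * chi2 (1 + real n) y))" if "m0 y \<noteq> 0" for y
    proof -
      have "(\<lambda>n. (1 + real n - ?c) * chi2 (1 + real n) y) \<longlonglongrightarrow> (m2 y - m0 y)\<^sup>2 / m0 y"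
      proof -
        have lim: "(\<lambda>n. (v + u * inverse (real (Suc n))) ) \<longlonglongrightarrow> v + u * 0" for u v :: real
          by (intro tendsto_intros LIMSEQ_inverse_real_of_nat)
        have "(\<lambda>n. (1 + (- ?c) * inverse (real (Suc n))) * ((m2 y - m0 y)\<^sup>2 / (m0 y + a * m2 y * inverse (real (Suc n)))))
          \<longlonglongrightarrow> (1 + (- ?c) * 0) * ((m2 y - m0 y)\<^sup>2 / (m0 y + a * m2 y * 0))"
          using that by (intro tendsto_mult tendsto_divide tendsto_const lim) auto
        moreover have "(1 + (- ?c) * inverse (real (Suc n))) * ((m2 y - m0 y)\<^sup>2 / (m0 y + a * m2 y * inverse (real (Suc n))))
          = (1 + real n - ?c) * chi2 (1 + real n) y" for n
        proof -
          \<comment> \<open>numerator and denominator are divided by \<open>N = n + 1\<close>, the value of \<open>\<beta>\<close>\<close>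
          have gen: "(1 + (- c) * inverse N) * (k / (m + u * inverse N)) = (N - c) * (k / (u + N * m))"
            if "N > 0" for N c k m u :: real
          proof -
            have "m + u * inverse N = (u + N * m) / N" using that by (simp add: field_simps)
            moreover have "1 + (- c) * inverse N = (N - c) / N" using that by (simp add: field_simps)
            ultimately show ?thesis using that by simp
          qed
          show ?thesis using gen[of "1 + real n" ?c] by simp
        qed
        ultimately show ?thesis by simp
      qed
      then have "(\<lambda>n. ennreal ((1 + real n - ?c) * chi2 (1 + real n) y)) \<longlonglongrightarrow> ennreal ((m2 y - m0 y)\<^sup>2 / m0 y)"
        by (rule tendsto_ennrealI)
      then show ?thesis by (rule lim_imp_Liminf[OF sequentially_bot, symmetric])
    qed
    have "V \<le> (\<integral>\<^sup>+y. liminf (\<lambda>n. ennreal ((1 + real n - ?c) * chi2 (1 + real n) y)) \<partial>lborel)"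
    proof (rule nn_integral_mono)
      fix y show "ennreal ((m2 y - m0 y)\<^sup>2 / m0 y)
        \<le> liminf (\<lambda>n. ennreal ((1 + real n - ?c) * chi2 (1 + real n) y))"
        using pt[of y] by (cases "m0 y = 0") simp_all
    qed
    also have "\<dots> \<le> liminf (\<lambda>n. \<integral>\<^sup>+y. ennreal ((1 + real n - ?c) * chi2 (1 + real n) y) \<partial>lborel)"
      by (rule nn_integral_liminf) simp
    also have "\<dots> \<le> ennreal ?x"
    proof -
      have "(\<integral>\<^sup>+y. ennreal ((1 + real n - ?c) * chi2 (1 + real n) y) \<partial>lborel) = ennreal (?F (1 + real n))" for n
        using a chi2_bounds(1)[of "1 + real n"]
        by (intro nn_integral_eq_integral integrable_mult_right chi2_integrable AE_I2 mult_nonneg_nonneg) auto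
      then have "(\<integral>\<^sup>+y. ennreal ((1 + real n - ?c) * chi2 (1 + real n) y) \<partial>lborel) \<le> ennreal ?x" for n
        using lt[of n] by (simp add: ennreal_leI less_imp_le del: times_divide_eq_right)
      then show ?thesis by (intro Liminf_le) (auto intro!: eventuallyI)
    qed
    finally show False using V by simp
  qed
  then obtain n where n: "?F (1 + real n) \<ge> ?x" by blast
  have cont: "continuous_on {?c..1 + real n} ?F"
  proof (rule continuous_on_integral_dominated)
    show "integrable lborel (\<lambda>y. (1 + real n) * ((m2 y + m0 y) / min a ?c))" using integrable_m by simp
    show "AE y in lborel. \<bar>(\<beta> - ?c) * chi2 \<beta> y\<bar> \<le> (1 + real n) * ((m2 y + m0 y) / min a ?c)"
      if "\<beta> \<in> {?c..1 + real n}" for \<beta>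
    proof (rule AE_I2)
      fix y
      show "\<bar>(\<beta> - ?c) * chi2 \<beta> y\<bar> \<le> (1 + real n) * ((m2 y + m0 y) / min a ?c)"
      proof -
        have "1 - a \<le> \<beta>" "\<bar>\<beta> - ?c\<bar> \<le> 1 + real n" using that a by auto
        with chi2_bounds[of \<beta> y] show ?thesis unfolding abs_mult by (intro mult_mono) linarith+
      qed
    qed
    show "AE y in lborel. continuous_on {?c..1 + real n} (\<lambda>\<beta>. (\<beta> - ?c) * chi2 \<beta> y)"
    proof (rule AE_I2)
      fix y show "continuous_on {?c..1 + real n} (\<lambda>\<beta>. (\<beta> - ?c) * chi2 \<beta> y)"
      proof (cases "m2 y = 0 \<and> m0 y = 0")
        case False
        then have "m2 y + m0 y > 0" using m0(2)[of y] m2(2)[of y] by linarith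
        then have "min a (1 - a) * (m2 y + m0 y) > 0" using a by simp
        then have "a * m2 y + \<beta> * m0 y \<noteq> 0" if "\<beta> \<in> {?c..1 + real n}" for \<beta>
          using denominator_ge[of \<beta> y] that by auto
        then show ?thesis by (intro continuous_intros) auto
      qed simp
    qed
  qed simp
  have "?F ?c \<le> ?x" using x by simp
  from IVT'[OF this n _ cont] a obtain \<beta> where \<beta>: "?c \<le> \<beta>" "?F \<beta> = ?x" by auto
  moreover have "\<beta> \<noteq> ?c" using \<beta>(2) x by auto
  ultimately show ?thesis
    by (intro exI[of _ \<beta>]) (auto simp: is_beta_star_iff simp del: times_divide_eq_right)
qed

section \<open>Two quadratic bounds\<close>

text \<open>The three moments of a function \<open>w\<close> of \<open>Y\<close> that enter the spectral equation and the overlap, as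
  Lebesgue integrals.\<close>
lemma
  assumes w[measurable]: "w \<in> borel_measurable borel" and b: "AE x in M. \<bar>w (snd x)\<bar> \<le> C"
  shows integral_linear: "(LINT x|M. w (snd x) * ((fst x)\<^sup>2 - 1)) = (LINT y|lborel. w y * (m2 y - m0 y))"
    and integrable_linear: "integrable lborel (\<lambda>y. w y * (m2 y - m0 y))"
    and integral_square: "(LINT x|M. (w (snd x))\<^sup>2) = (LINT y|lborel. (w y)\<^sup>2 * m0 y)"
    and integrable_square: "integrable lborel (\<lambda>y. (w y)\<^sup>2 * m0 y)"
    and integral_square_G2: "(LINT x|M. (w (snd x))\<^sup>2 * ((fst x)\<^sup>2 - 1))
        = (LINT y|lborel. (w y)\<^sup>2 * m2 y) - (LINT y|lborel. (w y)\<^sup>2 * m0 y)"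
    and integrable_square_G2: "integrable lborel (\<lambda>y. (w y)\<^sup>2 * m2 y)"
proof -
  have b2: "AE x in M. \<bar>(w (snd x))\<^sup>2\<bar> \<le> C\<^sup>2"
    using b
  proof eventually_elim
    case (elim x)
    from power_mono[OF this, of 2] show ?case by simp
  qed
  note i = integrable_bounded[OF _ b] and j = integrable_bounded[OF _ b2]
  have i': "integrable lborel (\<lambda>y. w y * m0 y)" "integrable lborel (\<lambda>y. w y * m2 y)"
    using i(1,2) integrable_m0[of w] integrable_m2[of w] by auto
  show "integrable lborel (\<lambda>y. w y * (m2 y - m0 y))"
    using i' by (simp add: right_diff_distrib)
  show "(LINT x|M. w (snd x) * ((fst x)\<^sup>2 - 1)) = (LINT y|lborel. w y * (m2 y - m0 y))"
    using i i' integral_m0[of w] integral_m2[of w] by (simp add: right_diff_distrib)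
  show j': "integrable lborel (\<lambda>y. (w y)\<^sup>2 * m0 y)" "integrable lborel (\<lambda>y. (w y)\<^sup>2 * m2 y)"
    using j(1,2) integrable_m0[of "\<lambda>y. (w y)\<^sup>2"] integrable_m2[of "\<lambda>y. (w y)\<^sup>2"] by auto
  show "(LINT x|M. (w (snd x))\<^sup>2) = (LINT y|lborel. (w y)\<^sup>2 * m0 y)"
    using integral_m0[of "\<lambda>y. (w y)\<^sup>2"] by simp
  show "(LINT x|M. (w (snd x))\<^sup>2 * ((fst x)\<^sup>2 - 1))
        = (LINT y|lborel. (w y)\<^sup>2 * m2 y) - (LINT y|lborel. (w y)\<^sup>2 * m0 y)"
    using j integral_m0[of "\<lambda>y. (w y)\<^sup>2"] integral_m2[of "\<lambda>y. (w y)\<^sup>2"] by (simp add: right_diff_distrib)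
qed

text \<open>Integrating \<open>0 \<le> (w - a (R - 1))\<^sup>2\<close> against the law of \<open>Y\<close> gives
  \<open>2 / \<delta> \<le> E[w\<^sup>2] + a\<^sup>2 V\<close>. The argument is by contradiction because the square is integrable only if \<open>V\<close>
  is finite.\<close>
lemma detection_bound:
  assumes w[measurable]: "w \<in> borel_measurable borel" and b: "AE x in M. \<bar>w (snd x)\<bar> \<le> C"
    and d: "\<delta> > 0" and e: "(LINT x|M. w (snd x) * ((fst x)\<^sup>2 - 1)) = 1 / (a * \<delta>)"
    and q: "(LINT x|M. (w (snd x))\<^sup>2) < 1 / \<delta>"
  shows "ennreal (1 / (a\<^sup>2 * \<delta>)) < V"
proof (rule ccontr)
  assume "\<not> ennreal (1 / (a\<^sup>2 * \<delta>)) < V"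
  then have V: "V \<le> ennreal (1 / (a\<^sup>2 * \<delta>))" by simp
  let ?h = "\<lambda>y. (m2 y - m0 y)\<^sup>2 / m0 y"
  have h: "integrable lborel ?h"
  proof (rule integrableI_nonneg)
    show "AE y in lborel. 0 \<le> ?h y" by (simp add: m0)
    show "V < \<infinity>" using V by (rule le_less_trans) simp
  qed simp
  have "V = ennreal (LINT y|lborel. ?h y)"
    using h by (rule nn_integral_eq_integral) (simp add: m0)
  then have hV: "(LINT y|lborel. ?h y) \<le> 1 / (a\<^sup>2 * \<delta>)"
    using V d a by (simp add: ennreal_le_iff)
  have "(LINT y|lborel. 2 * a * (w y * (m2 y - m0 y))) \<le> (LINT y|lborel. (w y)\<^sup>2 * m0 y + a\<^sup>2 * ?h y)"
  proof (rule integral_mono_AE)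
    show "AE y in lborel. 2 * a * (w y * (m2 y - m0 y)) \<le> (w y)\<^sup>2 * m0 y + a\<^sup>2 * ?h y"
      using AE_m2_eq_0
    proof eventually_elim
      case (elim y)
      show ?case
      proof (cases "m0 y = 0")
        case False
        have sq: "(w y)\<^sup>2 * m0 y + a\<^sup>2 * ?h y - 2 * a * (w y * (m2 y - m0 y))
          = m0 y * (w y - a * ((m2 y - m0 y) / m0 y))\<^sup>2"
          using False by (simp add: field_simps power2_eq_square)
        have "0 \<le> m0 y * (w y - a * ((m2 y - m0 y) / m0 y))\<^sup>2" using m0(2)[of y] by simp
        then show ?thesis unfolding sq[symmetric] by simp
      qed (use elim in simp)
    qed
  qed (use h integrable_linear[OF w b] integrable_square[OF w b] in
      \<open>auto intro!: integrable_mult_right simp del: times_divide_eq_right\<close>)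
  also have "\<dots> = (LINT y|lborel. (w y)\<^sup>2 * m0 y) + a\<^sup>2 * (LINT y|lborel. ?h y)"
    using h integrable_square[OF w b] by (simp add: integrable_mult_right del: times_divide_eq_right)
  also have "\<dots> \<le> (LINT y|lborel. (w y)\<^sup>2 * m0 y) + a\<^sup>2 * (1 / (a\<^sup>2 * \<delta>))"
    using hV by (intro add_left_mono mult_left_mono) auto
  also have "\<dots> < 1 / \<delta> + 1 / \<delta>"
    using q a integral_square[OF w b] by simp
  finally have "2 * a * (LINT y|lborel. w y * (m2 y - m0 y)) < 2 / \<delta>" by simp
  then show False using e a integral_linear[OF w b] by simp
qed

text \<open>Completing the square with weight \<open>a * m2 + \<beta> * m0\<close>. The multiplier \<open>a * (\<beta> - (1 - a))\<close> is
  the one that makes the bound sharp when \<open>\<beta>\<close> solves the fixed point equation.\<close>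
lemma overlap_bound:
  assumes w[measurable]: "w \<in> borel_measurable borel" and b: "AE x in M. \<bar>w (snd x)\<bar> \<le> C"
    and d: "\<delta> > 0" and e: "(LINT x|M. w (snd x) * ((fst x)\<^sup>2 - 1)) = 1 / (a * \<delta>)"
    and \<beta>: "is_beta_star M m0 m2 a \<delta> \<beta>"
  shows "(\<beta> + a) * (1 / \<delta> - (LINT x|M. (w (snd x))\<^sup>2))
    \<le> 1 / \<delta> + a * (LINT x|M. (w (snd x))\<^sup>2 * ((fst x)\<^sup>2 - 1))"
proof -
  define c where "c = 1 - a"
  define t where "t = a * (\<beta> - c)"
  have gt: "\<beta> > c" and fp: "(\<beta> - c) * (LINT y|lborel. chi2 \<beta> y) = 1 / (a\<^sup>2 * \<delta>)"
    using \<beta> by (auto simp: is_beta_star_iff c_def integral_mult_right_zero simp del: times_divide_eq_right)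
  have chi: "integrable lborel (chi2 \<beta>)" using gt by (intro chi2_integrable) (simp add: c_def)
  note i = integrable_linear[OF w b] integrable_square[OF w b] integrable_square_G2[OF w b]
  have "(LINT y|lborel. 2 * t * (w y * (m2 y - m0 y)))
    \<le> (LINT y|lborel. a * ((w y)\<^sup>2 * m2 y) + \<beta> * ((w y)\<^sup>2 * m0 y) + t\<^sup>2 * chi2 \<beta> y)"
  proof (rule integral_mono_AE)
    show "AE y in lborel. 2 * t * (w y * (m2 y - m0 y))
      \<le> a * ((w y)\<^sup>2 * m2 y) + \<beta> * ((w y)\<^sup>2 * m0 y) + t\<^sup>2 * chi2 \<beta> y"
    proof (rule AE_I2)
      fix y
      let ?D = "a * m2 y + \<beta> * m0 y"
      show "2 * t * (w y * (m2 y - m0 y))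
        \<le> a * ((w y)\<^sup>2 * m2 y) + \<beta> * ((w y)\<^sup>2 * m0 y) + t\<^sup>2 * chi2 \<beta> y"
      proof (cases "m2 y = 0 \<and> m0 y = 0")
        case False
        then have "m2 y + m0 y > 0" using m0(2)[of y] m2(2)[of y] by linarith
        then have "min a (1 - a) * (m2 y + m0 y) > 0" using a by simp
        then have D: "?D > 0" using denominator_ge[of \<beta> y] gt by (auto simp: c_def)
        have gen: "W\<^sup>2 * E + t\<^sup>2 * (g\<^sup>2 / E) - 2 * t * (W * g) = E * (W - t * (g / E))\<^sup>2"
          if "E > 0" for E W g :: real
          using that by (simp add: field_simps power2_eq_square)
        have "0 \<le> ?D * (w y - t * ((m2 y - m0 y) / ?D))\<^sup>2" using D by simp
        then have "2 * t * (w y * (m2 y - m0 y)) \<le> (w y)\<^sup>2 * ?D + t\<^sup>2 * chi2 \<beta> y"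
          unfolding gen[OF D, symmetric] by simp
        then show ?thesis by (simp add: algebra_simps)
      qed simp
    qed
  qed (use i chi in \<open>auto intro!: integrable_mult_right simp del: times_divide_eq_right\<close>)
  also have "\<dots> = a * (LINT y|lborel. (w y)\<^sup>2 * m2 y) + \<beta> * (LINT y|lborel. (w y)\<^sup>2 * m0 y)
      + t\<^sup>2 * (LINT y|lborel. chi2 \<beta> y)"
    using i chi by (simp add: integrable_mult_right del: times_divide_eq_right)
  also have "t\<^sup>2 * (LINT y|lborel. chi2 \<beta> y) = (\<beta> - c) / \<delta>"
  proof -
    have "t\<^sup>2 * (LINT y|lborel. chi2 \<beta> y) = a\<^sup>2 * (\<beta> - c) * ((\<beta> - c) * (LINT y|lborel. chi2 \<beta> y))"
      by (simp add: t_def power2_eq_square)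
    then show ?thesis unfolding fp using a by simp
  qed
  finally have "2 * t * (LINT y|lborel. w y * (m2 y - m0 y))
    \<le> a * (LINT y|lborel. (w y)\<^sup>2 * m2 y) + \<beta> * (LINT y|lborel. (w y)\<^sup>2 * m0 y) + (\<beta> - c) / \<delta>"
    by simp
  moreover have "2 * t * (LINT y|lborel. w y * (m2 y - m0 y)) = 2 * ((\<beta> - c) / \<delta>)"
    using e a integral_linear[OF w b] by (simp add: t_def)
  ultimately have "(\<beta> - c) / \<delta> \<le> a * (LINT y|lborel. (w y)\<^sup>2 * m2 y) + \<beta> * (LINT y|lborel. (w y)\<^sup>2 * m0 y)"
    by linarith
  then show ?thesis
    unfolding integral_square_G2[OF w b] integral_square[OF w b] c_def
    by (simp add: field_simps add_divide_distrib diff_divide_distrib)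
qed

section \<open>The optimal resolvent\<close>

text \<open>The equality case of \<open>overlap_bound\<close>.\<close>
definition opt :: "real \<Rightarrow> real \<Rightarrow> real" where
  "opt \<beta> y = a * (\<beta> - (1 - a)) * ((m2 y - m0 y) / (a * m2 y + \<beta> * m0 y))"

lemma opt_measurable[measurable]: "opt \<beta> \<in> borel_measurable borel"
  unfolding opt_def by measurable

lemma opt_bounds:
  assumes "\<beta> > 1 - a" shows "- a \<le> opt \<beta> y \<and> opt \<beta> y \<le> \<beta> - (1 - a)"
proof (cases "m2 y = 0 \<and> m0 y = 0")
  case True
  then show ?thesis using assms a by (simp add: opt_def)
next
  case False
  then have "m2 y + m0 y > 0" using m0(2)[of y] m2(2)[of y] by linarith
  then have "min a (1 - a) * (m2 y + m0 y) > 0" using a by simp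
  then have D: "a * m2 y + \<beta> * m0 y > 0" using denominator_ge[of \<beta> y] assms by auto
  have "- a * (a * m2 y + \<beta> * m0 y) \<le> a * (\<beta> - (1 - a)) * (m2 y - m0 y)"
  proof -
    have "0 \<le> a * ((\<beta> - (1 - a)) * m2 y + a * m2 y + (1 - a) * m0 y)"
      using assms a m0(2)[of y] m2(2)[of y] by (intro mult_nonneg_nonneg add_nonneg_nonneg) auto
    then show ?thesis by (simp add: algebra_simps)
  qed
  moreover have "a * (\<beta> - (1 - a)) * (m2 y - m0 y) \<le> (\<beta> - (1 - a)) * (a * m2 y + \<beta> * m0 y)"
  proof -
    have "0 \<le> (\<beta> - (1 - a)) * ((a + \<beta>) * m0 y)"
      using assms a m0(2)[of y] by (intro mult_nonneg_nonneg) auto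
    then show ?thesis by (simp add: algebra_simps)
  qed
  ultimately show ?thesis using D by (simp add: opt_def pos_le_divide_eq pos_divide_le_eq)
qed

lemma opt_abs_bound:
  assumes "\<beta> > 1 - a" shows "AE x in M. \<bar>opt \<beta> (snd x)\<bar> \<le> a + (\<beta> - (1 - a))"
proof (rule AE_I2)
  fix x show "\<bar>opt \<beta> (snd x)\<bar> \<le> a + (\<beta> - (1 - a))"
    using opt_bounds[OF assms, of "snd x"] a assms by linarith
qed

text \<open>The fixed point equation says that \<open>opt \<beta>\<close> solves the spectral equation; equality in the overlap
  bound is then \<open>E[opt\<^sup>2 (a G\<^sup>2 + \<beta>)] = (\<beta> - (1 - a)) / \<delta>\<close>. Subtracting \<open>E[opt\<^sup>2 (a G\<^sup>2 + 1 - a)]\<close>, which is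
  positive unless \<open>opt\<close> vanishes, leaves \<open>(\<beta> - (1 - a)) E[opt\<^sup>2] < (\<beta> - (1 - a)) / \<delta>\<close>. And \<open>opt\<close> must
  take positive values because it has the sign of \<open>R - 1\<close>, which has mean zero and, by the spectral
  equation, is not almost surely zero.\<close>
lemma
  assumes d: "\<delta> > 0" and \<beta>: "is_beta_star M m0 m2 a \<delta> \<beta>"
  shows opt_linear: "(LINT x|M. opt \<beta> (snd x) * ((fst x)\<^sup>2 - 1)) = 1 / (a * \<delta>)" (is ?lin)
    and opt_square: "(LINT x|M. (opt \<beta> (snd x))\<^sup>2) < 1 / \<delta>" (is ?sq)
    and opt_overlap: "(\<beta> + a) * (1 / \<delta> - (LINT x|M. (opt \<beta> (snd x))\<^sup>2))
      = 1 / \<delta> + a * (LINT x|M. (opt \<beta> (snd x))\<^sup>2 * ((fst x)\<^sup>2 - 1))" (is ?ov)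
    and opt_pos: "\<not> (AE x in M. opt \<beta> (snd x) \<le> 0)" (is ?pos)
proof -
  define c where "c = 1 - a"
  have gt: "\<beta> > 1 - a" "\<beta> > c" and fp: "(\<beta> - c) * (LINT y|lborel. chi2 \<beta> y) = 1 / (a\<^sup>2 * \<delta>)"
    using \<beta> by (auto simp: is_beta_star_iff c_def integral_mult_right_zero simp del: times_divide_eq_right)
  note w = opt_measurable[of \<beta>] opt_abs_bound[OF gt(1)]
  have "(LINT x|M. opt \<beta> (snd x) * ((fst x)\<^sup>2 - 1)) = (LINT y|lborel. a * (\<beta> - c) * chi2 \<beta> y)"
    unfolding integral_linear[OF w] by (simp add: opt_def c_def power2_eq_square mult_ac)
  also have "\<dots> = a * ((\<beta> - c) * (LINT y|lborel. chi2 \<beta> y))"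
    by (simp only: integral_mult_right_zero mult.assoc)
  also have "\<dots> = 1 / (a * \<delta>)" unfolding fp using a by (simp add: power2_eq_square)
  finally show lin: ?lin .
  let ?S0 = "LINT y|lborel. (opt \<beta> y)\<^sup>2 * m0 y" and ?S2 = "LINT y|lborel. (opt \<beta> y)\<^sup>2 * m2 y"
  note i = integrable_square[OF w] integrable_square_G2[OF w]
  have "a * ?S2 + \<beta> * ?S0 = (LINT y|lborel. a * ((opt \<beta> y)\<^sup>2 * m2 y) + \<beta> * ((opt \<beta> y)\<^sup>2 * m0 y))"
    using i by (simp add: integrable_mult_right)
  also have "\<dots> = (LINT y|lborel. a\<^sup>2 * (\<beta> - c)\<^sup>2 * chi2 \<beta> y)"
  proof (rule Bochner_Integration.integral_cong[OF refl])
    fix y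
    let ?D = "a * m2 y + \<beta> * m0 y"
    have "(u * (g / E))\<^sup>2 * E = u\<^sup>2 * (g\<^sup>2 / E)" for u g E :: real
      by (cases "E = 0") (auto simp: power2_eq_square)
    from this[of "a * (\<beta> - c)" "m2 y - m0 y" ?D]
    have "(opt \<beta> y)\<^sup>2 * ?D = (a * (\<beta> - c))\<^sup>2 * chi2 \<beta> y" unfolding opt_def c_def .
    then show "a * ((opt \<beta> y)\<^sup>2 * m2 y) + \<beta> * ((opt \<beta> y)\<^sup>2 * m0 y) = a\<^sup>2 * (\<beta> - c)\<^sup>2 * chi2 \<beta> y"
      by (simp only: power_mult_distrib distrib_left distrib_right mult_ac)
  qed
  also have "\<dots> = a\<^sup>2 * (\<beta> - c) * ((\<beta> - c) * (LINT y|lborel. chi2 \<beta> y))"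
    unfolding integral_mult_right_zero by (simp add: power2_eq_square)
  also have "\<dots> = (\<beta> - c) / \<delta>" unfolding fp using a by simp
  finally have eq: "a * ?S2 + \<beta> * ?S0 = (\<beta> - c) / \<delta>" .
  then show ?ov
    unfolding integral_square_G2[OF w] integral_square[OF w] c_def
    by (simp add: field_simps add_divide_distrib diff_divide_distrib)
  have nn: "?S2 \<ge> 0" "?S0 \<ge> 0" by (simp_all add: m0 m2)
  have "?S0 < 1 / \<delta>"
  proof (cases "?S0 = 0")
    case False
    have "(\<beta> - c) * ?S0 = (\<beta> - c) / \<delta> - a * ?S2 - c * ?S0" using eq by (simp add: algebra_simps)
    also have "\<dots> < (\<beta> - c) * (1 / \<delta>)"
    proof -
      have "0 \<le> a * ?S2" "0 < c * ?S0" using False nn a by (simp_all add: c_def)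
      then show ?thesis by simp
    qed
    finally show ?thesis using gt(2) by (simp only: mult_less_cancel_left_pos)
  qed (use d in simp)
  then show ?sq by (simp add: integral_square[OF w])
  show ?pos
  proof
    assume "AE x in M. opt \<beta> (snd x) \<le> 0"
    then have "AE y in lborel. m0 y \<noteq> 0 \<longrightarrow> opt \<beta> y \<le> 0" by (subst (asm) AE_law_Y_iff) auto
    then have le: "AE y in lborel. 0 \<le> m0 y - m2 y"
      using AE_m2_eq_0
    proof eventually_elim
      case (elim y)
      show ?case
      proof (rule ccontr)
        assume "\<not> 0 \<le> m0 y - m2 y"
        then have g: "m2 y - m0 y > 0" by simp
        then have "m0 y > 0" using elim m0(2)[of y] by (cases "m0 y = 0") auto
        moreover have "a * m2 y + \<beta> * m0 y > 0"
          using \<open>m0 y > 0\<close> a gt m2(2)[of y] by (intro add_nonneg_pos) auto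
        then have "opt \<beta> y > 0" unfolding opt_def using g gt a by simp
        ultimately show False using elim by auto
      qed
    qed
    have "(LINT y|lborel. m0 y - m2 y) = 0"
      using integrable_m integral_m by simp
    then have "AE y in lborel. m0 y - m2 y = 0"
      using le integrable_m by (subst (asm) integral_nonneg_eq_0_iff_AE) auto
    then have "(LINT y|lborel. opt \<beta> y * (m2 y - m0 y)) = 0"
      by (intro integral_eq_zero_AE) (auto elim: eventually_mono)
    then show False using lin integral_linear[OF w] a d by simp
  qed
qed


section \<open>Admissible functions and their overlap\<close>

text \<open>The overlap \<open>rho_spec\<close> as a functional of the resolvent \<open>w = T / (\<lambda>\<^sup>* - T)\<close> alone.\<close>
definition overlap :: "real \<Rightarrow> (real \<Rightarrow> real) \<Rightarrow> real" where
  "overlap \<delta> w = sqrt ((1 / \<delta> - (LINT x|M. (w (snd x))\<^sup>2)) /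
     (1 / \<delta> + a * (LINT x|M. (w (snd x))\<^sup>2 * ((fst x)\<^sup>2 - 1))))"

lemma rho_spec_eq_overlap:
  assumes "lam_star M T (a * \<delta>) = l" and [measurable]: "T \<in> borel_measurable borel" "w \<in> borel_measurable borel"
    and w: "AE x in M. T (snd x) / (l - T (snd x)) = w (snd x)"
  shows "rho_spec M a \<delta> T = overlap \<delta> w"
proof -
  have "(LINT x|M. (T (snd x) / (l - T (snd x)))\<^sup>2) = (LINT x|M. (w (snd x))\<^sup>2)"
    using w by (intro integral_cong_AE) (auto elim!: eventually_mono)
  moreover have "(LINT x|M. (T (snd x) / (l - T (snd x)))\<^sup>2 * ((fst x)\<^sup>2 - 1)) = (LINT x|M. (w (snd x))\<^sup>2 * ((fst x)\<^sup>2 - 1))"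
    using w by (intro integral_cong_AE) (auto elim!: eventually_mono)
  ultimately show ?thesis by (simp only: rho_spec_def overlap_def assms(1) Let_def)
qed

lemma sqrt_ratio_le:
  fixes N D k :: real
  assumes "N \<ge> 0" "k > 0" "k * N \<le> D" shows "sqrt (N / D) \<le> 1 / sqrt k"
proof -
  have "N / D \<le> 1 / k"
  proof (cases "N = 0")
    case False
    then have "k * N > 0" using assms by simp
    then have "D > 0" using assms by linarith
    then show ?thesis using assms by (simp add: field_simps)
  qed (use assms in simp)
  then have "sqrt (N / D) \<le> sqrt (1 / k)" by simp
  then show ?thesis by (simp add: real_sqrt_divide)
qed

lemma overlap_opt:
  assumes d: "\<delta> > 0" and \<beta>: "is_beta_star M m0 m2 a \<delta> \<beta>"
  shows "overlap \<delta> (opt \<beta>) = 1 / sqrt (\<beta> + a)"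
proof -
  have "1 / \<delta> - (LINT x|M. (opt \<beta> (snd x))\<^sup>2) \<noteq> 0" using opt_square[OF d \<beta>] by simp
  moreover have "\<beta> + a \<noteq> 0" using \<beta> by (simp add: is_beta_star_def)
  ultimately show ?thesis
    unfolding overlap_def opt_overlap[OF d \<beta>, symmetric] by (simp add: real_sqrt_divide)
qed

lemma AE_in_supp_M: "AE x in M. snd x \<in> supp (law_Y M)"
  using AE_in_supp_law_Y by (subst AE_law_Y_iff) auto

text \<open>This makes the two quadratic bounds applicable to the class. By continuity, a positive supremum of
  \<open>T\<close> over the support of \<open>Y\<close> forces \<open>sup supp Z > 0\<close>, so \<open>lam_star_iff_moments\<close> applies with \<open>w\<close> the
  resolvent at \<open>\<lambda>\<^sup>*\<close>.\<close>
lemma H_class_resolvent: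
  assumes T: "T \<in> H_class M a \<delta>" and d: "\<delta> > 0"
  obtains w C where "w \<in> borel_measurable borel" "AE x in M. \<bar>w (snd x)\<bar> \<le> C"
    "(LINT x|M. w (snd x) * ((fst x)\<^sup>2 - 1)) = 1 / (a * \<delta>)"
    "(LINT x|M. (w (snd x))\<^sup>2) < 1 / \<delta>" "rho_spec M a \<delta> T = overlap \<delta> w"
proof -
  let ?S = "supp (law_Y M)"
  have "lipschitz T" using T by (simp add: H_class_def)
  note cont = lipschitz_imp_continuous[OF this]
    and [measurable] = lipschitz_imp_measurable[OF this]
  have adm: "bdd_below (T ` ?S)" "bdd_above (T ` ?S)" "0 < (SUP y\<in>?S. T y)"
    "measure M {x \<in> space M. T (snd x) = 0} < 1"
    "\<exists>!l. is_lam_star M T (a * \<delta>) l" "lam_bar M T \<delta> < lam_star M T (a * \<delta>)"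
    using T by (auto simp: H_class_def admissible_def)
  obtain u v where uv: "\<And>y. y \<in> ?S \<Longrightarrow> u \<le> T y" "\<And>y. y \<in> ?S \<Longrightarrow> T y \<le> v"
    using adm(1,2) by (auto simp: bdd_below_def bdd_above_def)
  define B where "B = max \<bar>u\<bar> \<bar>v\<bar>"
  have B: "AE x in M. \<bar>T (snd x)\<bar> \<le> B"
    using AE_in_supp_M by eventually_elim (use uv in \<open>force simp: B_def abs_le_iff le_max_iff_disj\<close>)
  have ne: "\<not> (AE x in M. T (snd x) = 0)"
  proof
    assume "AE x in M. T (snd x) = 0"
    then have "prob {x \<in> space M. T (snd x) = 0} = 1" by (intro prob_Collect_eq_1[THEN iffD2]) auto
    then show False using adm(4) by simp
  qed
  interpret preprocessed M T B by unfold_locales (use B ne in auto)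
  have "\<not> (AE x in M. T (snd x) \<le> 0)"
  proof
    assume "AE x in M. T (snd x) \<le> 0"
    then have "AE y in law_Y M. T y \<in> {..0}" unfolding law_Y_def by (subst AE_distr_iff) auto
    then have le: "T y \<le> 0" if "y \<in> ?S" for y
      using supp_in_closed[of "law_Y M" T "{..0}" y] cont that by (simp add: law_Y_def)
    have "?S \<noteq> {}" using AE_in_supp_M AE_False by fastforce
    then have "(SUP y\<in>?S. T y) \<le> 0" using le by (intro cSUP_least)
    then show False using adm(3) by simp
  qed
  then have s: "s > 0" by (rule sup_supp_Z_pos)
  define l where "l = lam_star M T (a * \<delta>)"
  have l: "l > s" "(LINT x|M. T (snd x) / (l - T (snd x)) * ((fst x)\<^sup>2 - 1)) = 1 / (a * \<delta>)"
    "second_moment l < 1 / \<delta>"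
    using lam_star_iff_moments[OF d a s, of l] adm(5,6) by (auto simp: l_def)
  show ?thesis
  proof (rule that)
    show "(\<lambda>y. T y / (l - T y)) \<in> borel_measurable borel" by simp
    show "rho_spec M a \<delta> T = overlap \<delta> (\<lambda>y. T y / (l - T y))"
      by (rule rho_spec_eq_overlap[where l = l]) (simp_all add: l_def)
  qed (use l resolvent_bound[OF l(1)] in auto)
qed

text \<open>The converse direction, used both for \<open>T_star\<close> and for its Lipschitz approximations. Taking positive
  values with positive probability makes \<open>sup supp Z\<close> and the supremum of \<open>T\<close> over the support of \<open>Y\<close>
  positive.\<close>
lemma admissibleI:
  assumes [measurable]: "T \<in> borel_measurable borel" and d: "\<delta> > 0"
    and bnd: "\<And>y. y \<in> supp (law_Y M) \<Longrightarrow> \<bar>T y\<bar> \<le> B"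
    and pos: "\<not> (AE x in M. T (snd x) \<le> 0)"
    and b: "AE x in M. T (snd x) \<le> b" "b < l"
    and lin: "(LINT x|M. T (snd x) / (l - T (snd x)) * ((fst x)\<^sup>2 - 1)) = 1 / (a * \<delta>)"
    and sq: "(LINT x|M. (T (snd x) / (l - T (snd x)))\<^sup>2) < 1 / \<delta>"
  shows "admissible M a \<delta> T \<and> lam_star M T (a * \<delta>) = l"
proof -
  let ?S = "supp (law_Y M)"
  have ne: "\<not> (AE x in M. T (snd x) = 0)"
  proof
    assume "AE x in M. T (snd x) = 0"
    then have "AE x in M. T (snd x) \<le> 0" by eventually_elim simp
    with pos show False ..
  qed
  interpret preprocessed M T B
    by unfold_locales (use AE_in_supp_M bnd ne in \<open>auto elim: eventually_mono\<close>)
  have s: "s > 0" using pos by (rule sup_supp_Z_pos)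
  have "l > s" using sup_supp_Z_le[OF b(1)] b(2) by simp
  then have *: "(\<exists>!l. is_lam_star M T (a * \<delta>) l) \<and> lam_star M T (a * \<delta>) = l \<and> lam_bar M T \<delta> < l"
    using lam_star_iff_moments[OF d a s, of l] lin sq by blast
  have bdd: "bdd_below (T ` ?S)" "bdd_above (T ` ?S)"
    unfolding bdd_below_def bdd_above_def using bnd by (auto simp: abs_le_iff minus_le_iff)
  have "\<exists>y\<in>?S. T y > 0"
  proof (rule ccontr)
    assume "\<not> (\<exists>y\<in>?S. T y > 0)"
    then have "AE x in M. T (snd x) \<le> 0" using AE_in_supp_M by (auto elim: eventually_mono simp: not_less)
    with pos show False ..
  qed
  then have "0 < (SUP y\<in>?S. T y)" using bdd(2) by (auto intro: less_le_trans cSUP_upper)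
  moreover have "prob {x \<in> space M. T (snd x) = 0} < 1"
  proof -
    have "prob {x \<in> space M. T (snd x) = 0} \<noteq> 1" using ne by (subst prob_Collect_eq_1) auto
    then show ?thesis using prob_le_1[of "{x \<in> space M. T (snd x) = 0}"] by linarith
  qed
  ultimately show ?thesis using * bdd by (auto simp: admissible_def)
qed

lemma H_class_imp_detectable:
  assumes "T \<in> H_class M a \<delta>" "\<delta> > 0" shows "ennreal (1 / (a\<^sup>2 * \<delta>)) < V"
  by (rule H_class_resolvent[OF assms]) (rule detection_bound[OF _ _ assms(2)])

lemma H_class_rho_spec_le:
  assumes "T \<in> H_class M a \<delta>" "\<delta> > 0" and \<beta>: "is_beta_star M m0 m2 a \<delta> \<beta>"
  shows "rho_spec M a \<delta> T \<le> 1 / sqrt (\<beta> + a)"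
proof -
  obtain w C where w: "w \<in> borel_measurable borel" "AE x in M. \<bar>w (snd x)\<bar> \<le> C"
    "(LINT x|M. w (snd x) * ((fst x)\<^sup>2 - 1)) = 1 / (a * \<delta>)"
    "(LINT x|M. (w (snd x))\<^sup>2) < 1 / \<delta>" and rho: "rho_spec M a \<delta> T = overlap \<delta> w"
    using H_class_resolvent[OF assms(1,2)] by blast
  have "\<beta> + a > 0" using \<beta> by (simp add: is_beta_star_def)
  then show ?thesis unfolding rho overlap_def
    using w(4) overlap_bound[OF w(1,2) assms(2) w(3) \<beta>] by (intro sqrt_ratio_le) auto
qed

section \<open>The optimal preprocessing function\<close>

lemma T_star_measurable[measurable]: "T_star m0 m2 a \<in> borel_measurable borel"
  unfolding T_star_def by measurable

lemma T_star_bounds: "1 - 1 / (1 - a) \<le> T_star m0 m2 a y" "T_star m0 m2 a y \<le> 1"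
proof -
  have "1 - a \<le> a * (m2 y / m0 y) + (1 - a)" using a m0(2)[of y] m2(2)[of y] by simp
  then have "0 \<le> 1 / (a * (m2 y / m0 y) + (1 - a))" "1 / (a * (m2 y / m0 y) + (1 - a)) \<le> 1 / (1 - a)"
    using a by (auto intro!: divide_left_mono divide_nonneg_nonneg mult_pos_pos)
  then show "1 - 1 / (1 - a) \<le> T_star m0 m2 a y" "T_star m0 m2 a y \<le> 1" by (auto simp: T_star_def)
qed

text \<open>\<open>T_star\<close> does not depend on \<open>\<delta>\<close>. The dependence of its resolvent on \<open>\<delta>\<close> comes from the spectral
  parameter alone, which is \<open>1 + 1 / (\<beta> - (1 - a))\<close>.\<close>
lemma T_star_resolvent:
  assumes \<beta>: "\<beta> > 1 - a" and y: "m0 y \<noteq> 0" and l: "l = 1 + 1 / (\<beta> - (1 - a))"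
  shows "T_star m0 m2 a y / (l - T_star m0 m2 a y) = opt \<beta> y"
proof -
  define r where "r = m2 y / m0 y"
  have r: "r \<ge> 0" "m2 y = r * m0 y" using y m0(2)[of y] m2(2)[of y] by (auto simp: r_def)
  define c g where "c = 1 - a" and "g = \<beta> - c"
  have p: "c > 0" "g > 0" "a * r + c > 0" "a * r + \<beta> > 0"
    using a \<beta> r by (auto simp: c_def g_def intro!: add_nonneg_pos)
  have T: "T_star m0 m2 a y = 1 - 1 / (a * r + c)" by (simp add: T_star_def r_def c_def)
  have "l - T_star m0 m2 a y = 1 / g + 1 / (a * r + c)" by (simp add: T l g_def c_def)
  also have "\<dots> = (a * r + \<beta>) / (g * (a * r + c))" using p by (simp add: g_def field_simps)
  finally have 1: "l - T_star m0 m2 a y = (a * r + \<beta>) / (g * (a * r + c))" .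
  have 2: "T_star m0 m2 a y = a * (r - 1) / (a * r + c)"
    unfolding T using p by (simp add: field_simps c_def)
  have "T_star m0 m2 a y / (l - T_star m0 m2 a y) = a * g * ((r - 1) / (a * r + \<beta>))"
    unfolding 1 unfolding 2 using p by simp
  also have "(r - 1) / (a * r + \<beta>) = (m0 y * (r - 1)) / (m0 y * (a * r + \<beta>))"
    using y by simp
  also have "\<dots> = (m2 y - m0 y) / (a * m2 y + \<beta> * m0 y)"
    unfolding r(2) by (simp add: algebra_simps)
  finally show ?thesis by (simp add: opt_def g_def c_def)
qed

lemma AE_T_star_optimal:
  assumes d: "\<delta> > 0" and \<beta>: "is_beta_star M m0 m2 a \<delta> \<beta>"
    and [measurable]: "T \<in> borel_measurable borel"
    and bnd: "\<And>y. y \<in> supp (law_Y M) \<Longrightarrow> \<bar>T y\<bar> \<le> B"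
    and eq: "AE x in M. T (snd x) = T_star m0 m2 a (snd x)"
  shows "admissible M a \<delta> T \<and> rho_spec M a \<delta> T = 1 / sqrt (\<beta> + a)"
proof -
  have gt: "\<beta> > 1 - a" using \<beta> by (simp add: is_beta_star_def)
  define l where "l = 1 + 1 / (\<beta> - (1 - a))"
  have l: "l > 1" using gt by (simp add: l_def)
  have "AE x in M. m0 (snd x) \<noteq> 0" by (subst AE_law_Y_iff) auto
  then have res: "AE x in M. T (snd x) / (l - T (snd x)) = opt \<beta> (snd x)"
    using eq by eventually_elim (simp add: T_star_resolvent[OF gt _ l_def])
  have le1: "AE x in M. T (snd x) \<le> 1" using eq by eventually_elim (simp add: T_star_bounds)
  have pos: "\<not> (AE x in M. T (snd x) \<le> 0)"
  proof
    assume "AE x in M. T (snd x) \<le> 0"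
    then have "AE x in M. opt \<beta> (snd x) \<le> 0"
      using res
    proof eventually_elim
      case (elim x)
      have "T (snd x) / (l - T (snd x)) \<le> 0" using elim(1) l by (intro divide_nonpos_pos) auto
      then show ?case using elim(2) by simp
    qed
    with opt_pos[OF d \<beta>] show False ..
  qed
  have "(LINT x|M. T (snd x) / (l - T (snd x)) * ((fst x)\<^sup>2 - 1)) = (LINT x|M. opt \<beta> (snd x) * ((fst x)\<^sup>2 - 1))"
    using res by (intro integral_cong_AE) (auto elim!: eventually_mono simp del: times_divide_eq_left)
  moreover have "(LINT x|M. (T (snd x) / (l - T (snd x)))\<^sup>2) = (LINT x|M. (opt \<beta> (snd x))\<^sup>2)"
    using res by (intro integral_cong_AE) (auto elim!: eventually_mono)
  ultimately have "admissible M a \<delta> T \<and> lam_star M T (a * \<delta>) = l"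
    using opt_linear[OF d \<beta>] opt_square[OF d \<beta>] by (intro admissibleI[OF _ d bnd pos le1 l]) simp_all
  then show ?thesis using rho_spec_eq_overlap[OF _ _ _ res, of \<delta>] overlap_opt[OF d \<beta>] by simp
qed

lemma lipschitz_resolvent_inverse:
  assumes "lipschitz w" "c > 0" "\<And>y. c \<le> 1 + w y"
  shows "lipschitz (\<lambda>y. w y / (1 + w y))"
proof -
  obtain L where L: "L-lipschitz_on UNIV w" using assms by (auto simp: lipschitz_def)
  have L0: "L \<ge> 0" using L by (rule lipschitz_on_nonneg)
  have "(L / c\<^sup>2)-lipschitz_on UNIV (\<lambda>y. w y / (1 + w y))"
  proof (rule lipschitz_onI)
    show "0 \<le> L / c\<^sup>2" using L0 by simp
    fix x y :: real
    have p: "1 + w x > 0" "1 + w y > 0" using assms(2) assms(3)[of x] assms(3)[of y] by linarith+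
    have "w x / (1 + w x) - w y / (1 + w y) = (w x - w y) / ((1 + w x) * (1 + w y))"
      using p by (simp add: field_simps)
    then have "dist (w x / (1 + w x)) (w y / (1 + w y)) = \<bar>w x - w y\<bar> / ((1 + w x) * (1 + w y))"
      using p by (simp add: dist_real_def abs_mult)
    also have "\<dots> \<le> (L * dist x y) / c\<^sup>2"
    proof (rule frac_le)
      show "\<bar>w x - w y\<bar> \<le> L * dist x y" using lipschitz_onD[OF L, of x y] by (simp add: dist_real_def)
      show "c\<^sup>2 \<le> (1 + w x) * (1 + w y)"
        unfolding power2_eq_square using assms(2,3) p by (intro mult_mono) auto
    qed (use L0 assms in auto)
    finally show "dist (w x / (1 + w x)) (w y / (1 + w y)) \<le> L / c\<^sup>2 * dist x y" by simp
  qed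
  then show ?thesis by (auto simp: lipschitz_def)
qed

text \<open>\<open>T_star\<close> itself may fail to be Lipschitz. It is the resolvent that is approximated, not the
  preprocessing function: at spectral parameter \<open>1\<close> a resolvent \<open>w > -1\<close> belongs to \<open>w / (1 + w)\<close>.
  Rescaling \<open>w\<close> by a factor close to \<open>1\<close> then restores the spectral equation exactly, so \<open>\<lambda>\<^sup>* = 1\<close> along the
  whole sequence, and the overlap converges by dominated convergence.\<close>
lemma H_class_approximates_opt:
  assumes d: "\<delta> > 0" and \<beta>: "is_beta_star M m0 m2 a \<delta> \<beta>"
  obtains T where "\<And>n::nat. T n \<in> H_class M a \<delta>"
    and "(\<lambda>n. rho_spec M a \<delta> (T n)) \<longlonglongrightarrow> 1 / sqrt (\<beta> + a)"
proof -
  have gt: "\<beta> > 1 - a" using \<beta> by (simp add: is_beta_star_def)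
  define h where "h = \<beta> - (1 - a)"
  have h: "h > 0" using gt by (simp add: h_def)
  obtain F where F: "\<And>n. lipschitz (F n)" "\<And>n y. - a \<le> F n y \<and> F n y \<le> h"
    and lim: "AE y in lborel. (\<lambda>n::nat. F n y) \<longlonglongrightarrow> opt \<beta> y"
    using lipschitz_approx_AE[OF opt_measurable opt_bounds[OF gt]] unfolding h_def by blast
  have F_meas[measurable]: "F n \<in> borel_measurable borel" for n
    using F(1) by (rule lipschitz_imp_measurable)
  have F_abs: "\<bar>F n y\<bar> \<le> a + h" for n y using F(2)[of n y] a h by (auto simp: abs_le_iff)
  have limM: "AE x in M. (\<lambda>n. F n (snd x)) \<longlonglongrightarrow> opt \<beta> (snd x)"
  proof -
    have "AE y in lborel. m0 y \<noteq> 0 \<longrightarrow> (\<lambda>n. F n y) \<longlonglongrightarrow> opt \<beta> y" using lim by eventually_elim simp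
    then show ?thesis by (subst AE_law_Y_iff) auto
  qed
  have conv: "(\<lambda>n. LINT x|M. \<Phi> (F n (snd x)) * p (fst x)) \<longlonglongrightarrow> (LINT x|M. \<Phi> (opt \<beta> (snd x)) * p (fst x))"
    if \<Phi>: "continuous_on UNIV \<Phi>" "\<And>u. \<bar>u\<bar> \<le> a + h \<Longrightarrow> \<bar>\<Phi> u\<bar> \<le> K"
      and p[measurable]: "p \<in> borel_measurable borel" "\<And>g. \<bar>p g\<bar> \<le> g\<^sup>2 + 1"
    for \<Phi> p :: "real \<Rightarrow> real" and K
  proof (rule integral_dominated_convergence)
    have [measurable]: "\<Phi> \<in> borel_measurable borel" using \<Phi>(1) by (rule borel_measurable_continuous_onI)
    show "(\<lambda>x. \<Phi> (opt \<beta> (snd x)) * p (fst x)) \<in> borel_measurable M"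
      "\<And>n. (\<lambda>x. \<Phi> (F n (snd x)) * p (fst x)) \<in> borel_measurable M" by measurable
    show "integrable M (\<lambda>x. K * ((fst x)\<^sup>2 + 1))" using integrable_G2 by simp
    show "AE x in M. (\<lambda>n. \<Phi> (F n (snd x)) * p (fst x)) \<longlonglongrightarrow> \<Phi> (opt \<beta> (snd x)) * p (fst x)"
      using limM by eventually_elim
        (use \<Phi>(1) in \<open>auto intro!: tendsto_mult_right continuous_on_tendsto_compose[of UNIV \<Phi>]\<close>)
    show "AE x in M. norm (\<Phi> (F n (snd x)) * p (fst x)) \<le> K * ((fst x)\<^sup>2 + 1)" for n
    proof (rule AE_I2)
      fix x :: "real \<times> real"
      have "\<bar>\<Phi> (F n (snd x))\<bar> \<le> K" using F_abs by (rule \<Phi>(2))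
      then show "norm (\<Phi> (F n (snd x)) * p (fst x)) \<le> K * ((fst x)\<^sup>2 + 1)"
        unfolding real_norm_def abs_mult by (intro mult_mono p(2)) auto
    qed
  qed
  have sq_le: "\<bar>u\<^sup>2\<bar> \<le> (a + h)\<^sup>2" if "\<bar>u\<bar> \<le> a + h" for u :: real
    using power_mono[OF that, of 2] by simp
  have G_le: "\<bar>g\<^sup>2 - 1\<bar> \<le> g\<^sup>2 + 1" for g :: real by (simp add: abs_le_iff)
  define e where "e n = (LINT x|M. F n (snd x) * ((fst x)\<^sup>2 - 1))" for n
  have "e \<longlonglongrightarrow> 1 / (a * \<delta>)"
    using conv[of "\<lambda>u. u" "a + h" "\<lambda>g. g\<^sup>2 - 1"] G_le opt_linear[OF d \<beta>] by (simp add: e_def[abs_def])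
  define t where "t n = 1 / (a * \<delta>) / e n" for n
  have t1: "t \<longlonglongrightarrow> 1"
  proof -
    have "(\<lambda>n. 1 / (a * \<delta>) / e n) \<longlonglongrightarrow> 1 / (a * \<delta>) / (1 / (a * \<delta>))"
      using a d by (intro tendsto_intros \<open>e \<longlonglongrightarrow> 1 / (a * \<delta>)\<close>) auto
    then show ?thesis using a d by (simp add: t_def[abs_def])
  qed
  define w where "w n y = t n * F n y" for n y
  have w_meas[measurable]: "w n \<in> borel_measurable borel" for n unfolding w_def by measurable
  have sq_lim: "(\<lambda>n. LINT x|M. (w n (snd x))\<^sup>2) \<longlonglongrightarrow> (LINT x|M. (opt \<beta> (snd x))\<^sup>2)"
  proof -
    have "(\<lambda>n. (t n)\<^sup>2 * (LINT x|M. (F n (snd x))\<^sup>2 * 1)) \<longlonglongrightarrow> 1\<^sup>2 * (LINT x|M. (opt \<beta> (snd x))\<^sup>2 * 1)"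
      by (intro tendsto_mult tendsto_power t1 conv[of "\<lambda>u. u\<^sup>2" "(a + h)\<^sup>2" "\<lambda>_. 1"] sq_le continuous_intros) auto
    then show ?thesis by (simp add: w_def power_mult_distrib)
  qed
  have sqG_lim: "(\<lambda>n. LINT x|M. (w n (snd x))\<^sup>2 * ((fst x)\<^sup>2 - 1)) \<longlonglongrightarrow> (LINT x|M. (opt \<beta> (snd x))\<^sup>2 * ((fst x)\<^sup>2 - 1))"
  proof -
    have "(\<lambda>n. (t n)\<^sup>2 * (LINT x|M. (F n (snd x))\<^sup>2 * ((fst x)\<^sup>2 - 1)))
        \<longlonglongrightarrow> 1\<^sup>2 * (LINT x|M. (opt \<beta> (snd x))\<^sup>2 * ((fst x)\<^sup>2 - 1))"
      by (intro tendsto_mult tendsto_power t1 conv[of "\<lambda>u. u\<^sup>2" "(a + h)\<^sup>2" "\<lambda>g. g\<^sup>2 - 1"] sq_le continuous_intros G_le) auto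
    then show ?thesis by (simp add: w_def power_mult_distrib mult.assoc)
  qed
  have overlap_lim: "(\<lambda>n. overlap \<delta> (w n)) \<longlonglongrightarrow> 1 / sqrt (\<beta> + a)"
    unfolding overlap_opt[OF d \<beta>, symmetric] unfolding overlap_def
  proof (intro tendsto_intros sq_lim sqG_lim)
    have "\<beta> + a > 0" using gt by simp
    then have "(\<beta> + a) * (1 / \<delta> - (LINT x|M. (opt \<beta> (snd x))\<^sup>2)) > 0"
      using opt_square[OF d \<beta>] by simp
    then show "1 / \<delta> + a * (LINT x|M. (opt \<beta> (snd x))\<^sup>2 * ((fst x)\<^sup>2 - 1)) \<noteq> 0"
      using opt_overlap[OF d \<beta>] by simp
  qed
  \<comment> \<open>the positive part of the resolvent survives in the limit, so \<open>sup supp Z > 0\<close> eventually\<close>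
  have pos_lim: "(\<lambda>n. LINT x|M. max (F n (snd x)) 0) \<longlonglongrightarrow> (LINT x|M. max (opt \<beta> (snd x)) 0)"
    using conv[of "\<lambda>u. max u 0" "a + h" "\<lambda>_. 1"] a h by (simp add: continuous_on_max)
  have opt_pos_int: "(LINT x|M. max (opt \<beta> (snd x)) 0) > 0"
  proof -
    have i: "integrable M (\<lambda>x. max (opt \<beta> (snd x)) 0)"
    proof (rule integrable_bounded(1))
      show "AE x in M. \<bar>max (opt \<beta> (snd x)) 0\<bar> \<le> a + (\<beta> - (1 - a))"
        using opt_abs_bound[OF gt] by eventually_elim auto
    qed simp
    have "(LINT x|M. max (opt \<beta> (snd x)) 0) \<noteq> 0"
    proof
      assume "(LINT x|M. max (opt \<beta> (snd x)) 0) = 0"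
      then have "AE x in M. max (opt \<beta> (snd x)) 0 = 0"
        using i by (subst (asm) integral_nonneg_eq_0_iff_AE) auto
      then have "AE x in M. opt \<beta> (snd x) \<le> 0" by eventually_elim (simp add: max_def split: if_splits)
      with opt_pos[OF d \<beta>] show False ..
    qed
    moreover have "(LINT x|M. max (opt \<beta> (snd x)) 0) \<ge> 0" by simp
    ultimately show ?thesis by linarith
  qed
  \<comment> \<open>\<open>F n \<ge> - a\<close>, so once \<open>t n * a < k\<close> the rescaled resolvents stay above \<open>- k > -1\<close>\<close>
  define k where "k = (1 + a) / 2"
  have k: "a < k" "k < 1" "0 < k" using a by (auto simp: k_def)
  define good where "good n \<longleftrightarrow> e n \<noteq> 0 \<and> 0 < t n \<and> t n * a < k
    \<and> (LINT x|M. (w n (snd x))\<^sup>2) < 1 / \<delta> \<and> 0 < (LINT x|M. max (F n (snd x)) 0)" for n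
  have "\<forall>\<^sub>F n in sequentially. good n"
    unfolding good_def
  proof (intro eventually_conj)
    show "\<forall>\<^sub>F n in sequentially. e n \<noteq> 0"
      using \<open>e \<longlonglongrightarrow> 1 / (a * \<delta>)\<close> a d by (intro tendsto_imp_eventually_ne[of e "1 / (a * \<delta>)"]) auto
    show "\<forall>\<^sub>F n in sequentially. 0 < t n" using t1 by (rule order_tendstoD(1)) simp
    have "(\<lambda>n. t n * a) \<longlonglongrightarrow> 1 * a" by (intro tendsto_intros t1)
    then show "\<forall>\<^sub>F n in sequentially. t n * a < k" by (rule order_tendstoD(2)) (use k in simp)
    show "\<forall>\<^sub>F n in sequentially. (LINT x|M. (w n (snd x))\<^sup>2) < 1 / \<delta>"
      using sq_lim opt_square[OF d \<beta>] by (rule order_tendstoD(2))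
    show "\<forall>\<^sub>F n in sequentially. 0 < (LINT x|M. max (F n (snd x)) 0)"
      using pos_lim opt_pos_int by (rule order_tendstoD(1))
  qed
  then obtain N where N: "\<And>n. n \<ge> N \<Longrightarrow> good n" by (auto simp: eventually_sequentially)
  define T where "T n y = w n y / (1 + w n y)" for n y
  have T_H: "T n \<in> H_class M a \<delta> \<and> rho_spec M a \<delta> (T n) = overlap \<delta> (w n)" if "good n" for n
  proof -
    have g: "e n \<noteq> 0" "0 < t n" "t n * a < k" "(LINT x|M. (w n (snd x))\<^sup>2) < 1 / \<delta>"
       "0 < (LINT x|M. max (F n (snd x)) 0)" using that by (auto simp: good_def)
    have wlo: "1 - k \<le> 1 + w n y" for y
    proof -
      have "t n * (- a) \<le> w n y" unfolding w_def using F(2)[of n y] g by (intro mult_left_mono) auto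
      then show ?thesis using g(3) by simp
    qed
    have whi: "w n y \<le> t n * h" for y
      unfolding w_def using F(2)[of n y] g by (intro mult_left_mono) auto
    have p: "1 + w n y > 0" for y using wlo[of y] k by linarith
    have res: "T n y / (1 - T n y) = w n y" for y
      using p[of y] by (simp add: T_def field_simps)
    have T1: "T n y = 1 - 1 / (1 + w n y)" for y using p[of y] by (simp add: T_def field_simps)
    have Thi: "T n y \<le> 1 - 1 / (1 + t n * h)" for y
      unfolding T1 using p[of y] whi[of y] by (intro diff_left_mono divide_left_mono) auto
    have Tlo: "1 - 1 / (1 - k) \<le> T n y" for y
      unfolding T1 using wlo[of y] p[of y] k by (intro diff_left_mono divide_left_mono) auto
    have "t n * h > 0" using g h by simp
    then have b: "1 - 1 / (1 + t n * h) < 1" by simp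
    have T_meas: "T n \<in> borel_measurable borel" unfolding T_def by measurable
    have "lipschitz (w n)"
    proof -
      obtain L where "L-lipschitz_on UNIV (F n)" using F(1)[of n] by (auto simp: lipschitz_def)
      then have "(\<bar>t n\<bar> * L)-lipschitz_on UNIV (\<lambda>y. t n * F n y)" by (rule lipschitz_on_cmult_real)
      then show ?thesis by (auto simp: lipschitz_def w_def)
    qed
    then have lipT: "lipschitz (T n)"
      unfolding T_def using wlo k by (intro lipschitz_resolvent_inverse[where c = "1 - k"]) auto
    have "admissible M a \<delta> (T n) \<and> lam_star M (T n) (a * \<delta>) = 1"
    proof (rule admissibleI[OF T_meas d _ _ _ b])
      show "\<bar>T n y\<bar> \<le> 1 + 1 / (1 - k)" for y
      proof -
        have "1 / (1 + t n * h) > 0" "1 / (1 - k) > 0" using \<open>t n * h > 0\<close> k by simp_all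
        then show ?thesis using Tlo[of y] Thi[of y] unfolding abs_le_iff by linarith
      qed
      show "AE x in M. T n (snd x) \<le> 1 - 1 / (1 + t n * h)" by (simp add: Thi)
      show "\<not> (AE x in M. T n (snd x) \<le> 0)"
      proof
        assume "AE x in M. T n (snd x) \<le> 0"
        then have "AE x in M. max (F n (snd x)) 0 = 0"
        proof eventually_elim
          case (elim x)
          then have "w n (snd x) \<le> 0" using p[of "snd x"] by (simp add: T_def divide_le_0_iff)
          then show ?case using g by (simp add: w_def mult_le_0_iff)
        qed
        then have "(LINT x|M. max (F n (snd x)) 0) = 0" by (rule integral_eq_zero_AE)
        then show False using g by simp
      qed
      show "(LINT x|M. T n (snd x) / (1 - T n (snd x)) * ((fst x)\<^sup>2 - 1)) = 1 / (a * \<delta>)"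
      proof -
        have "(LINT x|M. T n (snd x) / (1 - T n (snd x)) * ((fst x)\<^sup>2 - 1)) = t n * e n"
          unfolding res w_def e_def by (simp add: mult.assoc)
        then show ?thesis using g by (simp add: t_def)
      qed
      show "(LINT x|M. (T n (snd x) / (1 - T n (snd x)))\<^sup>2) < 1 / \<delta>" unfolding res using g by simp
    qed
    then show ?thesis
      using lipT rho_spec_eq_overlap[of "T n" \<delta> 1 "w n"] T_meas res by (simp add: H_class_def)
  qed
  show ?thesis
  proof
    show "T (n + N) \<in> H_class M a \<delta>" for n using T_H N by simp
    have "(\<lambda>n. overlap \<delta> (w (n + N))) \<longlonglongrightarrow> 1 / sqrt (\<beta> + a)"
      using overlap_lim by (rule LIMSEQ_ignore_initial_segment)
    then show "(\<lambda>n. rho_spec M a \<delta> (T (n + N))) \<longlonglongrightarrow> 1 / sqrt (\<beta> + a)" using T_H N by simp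
  qed
qed

lemma OL_spec_eq:
  assumes d: "\<delta> > 0" and \<beta>: "is_beta_star M m0 m2 a \<delta> \<beta>"
  shows "OL_spec M a \<delta> = ereal (1 / sqrt (\<beta> + a))"
proof (rule antisym)
  show "OL_spec M a \<delta> \<le> ereal (1 / sqrt (\<beta> + a))"
    unfolding OL_spec_def
  proof (rule SUP_least)
    fix T assume "T \<in> H_class M a \<delta>"
    from H_class_rho_spec_le[OF this d \<beta>]
    show "ereal (rho_spec M a \<delta> T) \<le> ereal (1 / sqrt (\<beta> + a))" by simp
  qed
  obtain T where T: "\<And>n::nat. T n \<in> H_class M a \<delta>"
    and lim: "(\<lambda>n. rho_spec M a \<delta> (T n)) \<longlonglongrightarrow> 1 / sqrt (\<beta> + a)"
    using H_class_approximates_opt[OF d \<beta>] by blast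
  show "ereal (1 / sqrt (\<beta> + a)) \<le> OL_spec M a \<delta>"
  proof (rule LIMSEQ_le_const2)
    show "(\<lambda>n. ereal (rho_spec M a \<delta> (T n))) \<longlonglongrightarrow> ereal (1 / sqrt (\<beta> + a))" using lim by simp
    have "ereal (rho_spec M a \<delta> (T n)) \<le> OL_spec M a \<delta>" for n
      unfolding OL_spec_def using T by (rule SUP_upper)
    then show "\<exists>N. \<forall>n\<ge>N. ereal (rho_spec M a \<delta> (T n)) \<le> OL_spec M a \<delta>" by blast
  qed
qed

section \<open>The spectral threshold\<close>

lemma H_class_nonempty_iff:
  assumes "\<delta> > 0"
  shows "H_class M a \<delta> \<noteq> {} \<longleftrightarrow> ennreal (1 / (a\<^sup>2 * \<delta>)) < V"
  using H_class_imp_detectable[OF _ assms] beta_star_exists[OF assms] H_class_approximates_opt[OF assms]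
  by (metis ex_in_conv)

lemma threshold_less_iff:
  assumes "\<delta> > 0"
  shows "1 / (ennreal (a\<^sup>2) * V) < ennreal \<delta> \<longleftrightarrow> ennreal (1 / (a\<^sup>2 * \<delta>)) < V"
proof (cases V)
  case (real v)
  show ?thesis
  proof (cases "v = 0")
    case True
    then show ?thesis using real by simp
  next
    case False
    then have v: "v > 0" "V = ennreal v" using real by auto
    have "1 / (ennreal (a\<^sup>2) * V) = ennreal (1 / (a\<^sup>2 * v))"
      using v a by (simp add: ennreal_mult[symmetric] divide_ennreal[symmetric] ennreal_1[symmetric] del: ennreal_1)
    then show ?thesis using v assms a by (simp add: ennreal_less_iff field_simps)
  qed
next
  case top
  have "ennreal (a\<^sup>2) * V = top" using a top by (simp add: ennreal_mult_top)
  then show ?thesis using assms top by simp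
qed

text \<open>By the two equivalences above, \<open>H_class\<close> is nonempty exactly for the \<open>\<delta>\<close> above \<open>?t\<close>, and \<open>?t\<close> is the
  infimum of these since the order is dense. If \<open>V = 0\<close> there are none and both sides are infinite.\<close>
lemma spec_threshold_eq: "spec_threshold M a = 1 / (ennreal (a\<^sup>2) * V)" (is "_ = ?t")
proof -
  have S: "{ennreal \<delta> |\<delta>. 0 < \<delta> \<and> H_class M a \<delta> \<noteq> {}} = {ennreal \<delta> |\<delta>. 0 < \<delta> \<and> ?t < ennreal \<delta>}"
    using H_class_nonempty_iff threshold_less_iff by blast
  show ?thesis unfolding spec_threshold_def S
  proof (rule antisym)
    show "?t \<le> Inf {ennreal \<delta> |\<delta>. 0 < \<delta> \<and> ?t < ennreal \<delta>}" by (rule Inf_greatest) auto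
    show "Inf {ennreal \<delta> |\<delta>. 0 < \<delta> \<and> ?t < ennreal \<delta>} \<le> ?t"
    proof (rule dense_ge)
      fix x assume "?t < x"
      then obtain y where y: "?t < y" "y < x" using dense by blast
      then obtain d where d: "y = ennreal d" "d \<ge> 0" by (cases y) auto
      have "d > 0" using y d by (cases "d = 0") auto
      then have "Inf {ennreal \<delta> |\<delta>. 0 < \<delta> \<and> ?t < ennreal \<delta>} \<le> y" using y d by (intro Inf_lower) auto
      then show "Inf {ennreal \<delta> |\<delta>. 0 < \<delta> \<and> ?t < ennreal \<delta>} \<le> x" using y by simp
    qed
  qed
qed

end

section \<open>The model\<close>

lemma joint_law_law_GY:
  assumes P: "prob_space Peps" "sets Peps = sets borel" and q: "q \<in> borel_measurable (borel \<Otimes>\<^sub>M borel)"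
  shows "joint_law (law_GY q Peps)"
proof -
  let ?N = "density lborel (\<lambda>x. ennreal (std_normal_density x))"
  interpret E: prob_space Peps by fact
  interpret N: prob_space ?N by (rule prob_space_normal_density) simp
  interpret NE: pair_prob_space ?N Peps ..
  have sets_NE: "sets (?N \<Otimes>\<^sub>M Peps) = sets (borel \<Otimes>\<^sub>M borel)"
    using P by (intro sets_pair_measure_cong) auto
  have meas: "(\<lambda>(g, e). (g, q (g, e))) \<in> (?N \<Otimes>\<^sub>M Peps) \<rightarrow>\<^sub>M (borel \<Otimes>\<^sub>M borel)"
  proof -
    have "(\<lambda>(g, e). (g, q (g, e))) = (\<lambda>x. (fst x, q x))" by auto
    then show ?thesis using q by (subst measurable_cong_sets[OF sets_NE refl]) simp
  qed
  have mom: "integrable ?N (\<lambda>g. g\<^sup>2)" "(LINT g|?N. g\<^sup>2) = 1"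
    using std_normal_moment_even[of 1] integral_std_normal_moment_even[of 1]
    by (auto simp: integrable_density integral_density has_bochner_integral_iff)
  have fst_law: "distr (law_GY q Peps) borel fst = distr (?N \<Otimes>\<^sub>M Peps) borel fst"
    unfolding law_GY_def using meas by (subst distr_distr) (auto simp: comp_def case_prod_beta)
  have "distr (?N \<Otimes>\<^sub>M Peps) borel fst = distr (?N \<Otimes>\<^sub>M Peps) ?N fst" by (rule distr_cong) auto
  also have "\<dots> = ?N" by (rule E.distr_pair_fst)
  finally have eq: "distr (law_GY q Peps) borel fst = ?N" using fst_law by simp
  have m: "fst \<in> borel_measurable (law_GY q Peps)" by (simp add: law_GY_def)
  show ?thesis
  proof (rule joint_law.intro)
    show "prob_space (law_GY q Peps)" unfolding law_GY_def by (rule NE.prob_space_distr[OF meas])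
    show "joint_law_axioms (law_GY q Peps)"
    proof
      show "sets (law_GY q Peps) = sets (borel \<Otimes>\<^sub>M borel)" by (simp add: law_GY_def)
      show "integrable (law_GY q Peps) (\<lambda>x. (fst x)\<^sup>2)"
        using mom(1) integrable_distr_eq[OF m, of "\<lambda>g. g\<^sup>2"] unfolding eq by simp
      show "(LINT x|law_GY q Peps. (fst x)\<^sup>2) = 1"
        using mom(2) integral_distr[OF m, of "\<lambda>g. g\<^sup>2"] unfolding eq by simp
    qed
  qed
qed

theorem proposition3p14:
  fixes q :: "real \<times> real \<Rightarrow> real" and Peps :: "real measure"
    and \<alpha> a :: real and i :: nat
    and m0 m2 :: "real \<Rightarrow> real" and M :: "(real \<times> real) measure"
  assumes "1 / 2 < \<alpha>" and "\<alpha> < 1"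
    and "prob_space Peps" and "sets Peps = sets borel"
    and "integrable Peps (\<lambda>x. x\<^sup>2)"
    and "q \<in> borel_measurable (borel \<Otimes>\<^sub>M borel)"
    and "M = law_GY q Peps"
    and "moment_density M 0 m0" and "\<And>y. 0 \<le> m0 y"
    and "moment_density M 2 m2" and "\<And>y. 0 \<le> m2 y"
    and "i \<in> {1, 2}" and "a = weight \<alpha> i"
  shows
    "spec_threshold M a =
       1 / (ennreal (a\<^sup>2) *
            (\<integral>\<^sup>+y\<in>supp (law_Y M). ennreal ((m2 y - m0 y)\<^sup>2 / m0 y) \<partial>lborel)) \<and>
     (\<forall>\<delta>::real. ennreal \<delta> > spec_threshold M a \<longrightarrow>
        (\<exists>!\<beta>. is_beta_star M m0 m2 a \<delta> \<beta>) \<and>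
        (\<forall>\<beta>. is_beta_star M m0 m2 a \<delta> \<beta> \<longrightarrow> OL_spec M a \<delta> = ereal (1 / sqrt (\<beta> + a))) \<and>
        admissible M a \<delta> (T_star m0 m2 a) \<and>
        (lipschitz (T_star m0 m2 a) \<longrightarrow> T_star m0 m2 a \<in> H_class M a \<delta>) \<and>
        ereal (rho_spec M a \<delta> (T_star m0 m2 a)) = OL_spec M a \<delta> \<and>
        (\<forall>T. lipschitz T \<and> (AE y in law_Y M. T y = T_star m0 m2 a y) \<longrightarrow>
           T \<in> H_class M a \<delta> \<and> ereal (rho_spec M a \<delta> T) = OL_spec M a \<delta>))"
proof -
  interpret joint_law M unfolding assms(7) by (rule joint_law_law_GY) fact+
  have a: "0 < a" "a < 1" using assms by (auto simp: weight_def)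
  interpret spectral_model M m0 m2 a
    by unfold_locales (use assms a in auto)
  let ?T = "T_star m0 m2 a"
  have main: "(\<exists>!\<beta>. is_beta_star M m0 m2 a \<delta> \<beta>) \<and>
        (\<forall>\<beta>. is_beta_star M m0 m2 a \<delta> \<beta> \<longrightarrow> OL_spec M a \<delta> = ereal (1 / sqrt (\<beta> + a))) \<and>
        admissible M a \<delta> ?T \<and> (lipschitz ?T \<longrightarrow> ?T \<in> H_class M a \<delta>) \<and>
        ereal (rho_spec M a \<delta> ?T) = OL_spec M a \<delta> \<and>
        (\<forall>T. lipschitz T \<and> (AE y in law_Y M. T y = ?T y) \<longrightarrow>
           T \<in> H_class M a \<delta> \<and> ereal (rho_spec M a \<delta> T) = OL_spec M a \<delta>)"
    if gt: "ennreal \<delta> > spec_threshold M a" for \<delta>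
  proof -
    have "ennreal \<delta> > 0" using gt by (rule le_less_trans[rotated]) simp
    then have d: "\<delta> > 0" by simp
    then have "ennreal (1 / (a\<^sup>2 * \<delta>)) < V" using gt by (simp only: spec_threshold_eq threshold_less_iff)
    then obtain \<beta> where \<beta>: "is_beta_star M m0 m2 a \<delta> \<beta>" using beta_star_exists[OF d] by blast
    have uniq: "\<exists>!\<beta>. is_beta_star M m0 m2 a \<delta> \<beta>" using \<beta> beta_star_unique[OF _ _ d] by blast
    define B where "B = max 1 \<bar>1 - 1 / (1 - a)\<bar>"
    have B: "\<bar>t\<bar> \<le> B" if "t \<in> {1 - 1 / (1 - a)..1}" for t
      using that by (auto simp: B_def abs_le_iff le_max_iff_disj)
    have T_star: "admissible M a \<delta> ?T \<and> rho_spec M a \<delta> ?T = 1 / sqrt (\<beta> + a)"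
      using T_star_bounds by (intro AE_T_star_optimal[OF d \<beta> _ B]) auto
    have lip: "T \<in> H_class M a \<delta> \<and> rho_spec M a \<delta> T = 1 / sqrt (\<beta> + a)"
      if T: "lipschitz T" "AE y in law_Y M. T y = ?T y" for T
    proof -
      note cont = lipschitz_imp_continuous[OF T(1)]
      note T_meas[measurable] = lipschitz_imp_measurable[OF T(1)]
      have AE: "AE y in law_Y M. T y \<in> {1 - 1 / (1 - a)..1}"
        using T(2) by eventually_elim (simp add: T_star_bounds)
      have "T y \<in> {1 - 1 / (1 - a)..1}" if "y \<in> supp (law_Y M)" for y
        by (rule supp_in_closed[OF _ AE _ cont that]) (simp_all add: law_Y_def)
      moreover have "AE x in M. T (snd x) = ?T (snd x)"
        using T(2) unfolding law_Y_def by (subst (asm) AE_distr_iff) auto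
      ultimately show ?thesis
        using AE_T_star_optimal[OF d \<beta> T_meas B] T(1) by (auto simp: H_class_def)
    qed
    show ?thesis using uniq OL_spec_eq[OF d] OL_spec_eq[OF d \<beta>] T_star lip by (auto simp: H_class_def)
  qed
  show ?thesis using main by (simp add: spec_threshold_eq set_nn_integral_supp)
qed

end
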